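(* Let $n>1$, and let $\mathcal{S}$ be the full subcategory of $\mathcal{M}$ consisting of all modules of the form $$F_a(M_b^S)\qquad\text{and}\qquad F_a\circ F_\tau(M_b^S)$$ for all $a=(a_1,a_2,\ldots,a_n,1)\in(\mathbb{C}^* )^n\times\{1\}$, $S\subset\{1,\ldots,n\}$ and $b\in\mathbb{C}$. Then $\mathcal{S}$ is a skeleton of $\mathcal{M}$.
   Context: Let $e_{i,j}$ be the matrix units, $\mathfrak{h}$ the diagonal Cartan subalgebra of $\mathfrak{sl}_{n+1}=\mathfrak{sl}_{n+1}(\mathbb{C})$, $h_k:=e_{k,k}-\frac1{n+1}\sum_{m=1}^{n+1}e_{m,m}$ for $1\le k\le n$, so $\mathcal{U}(\mathfrak{h})=\mathcal{P}:=\mathbb{C}[h_1,\ldots,h_n]$, and $\overline{h}:=\sum_{i=1}^n h_i$. $\mathcal{M}$ is the full subcategory of $\mathcal{U}(\mathfrak{sl}_{n+1})$-modules whose restriction to $\mathcal{U}(\mathfrak{h})$ is free of rank $1$. For $1\le i\le n$, $\sigma_i$ is the algebra automorphism of $\mathcal{P}$ with $\sigma_i(h_k)=h_k-\delta_{i,k}$. For $S\subset\{1,\ldots,n\}$ (any subset, possibly empty or everything) and $b\in\mathbb{C}$, $M_b^S$ is the vector space $\mathcal{P}$ with the $\mathfrak{sl}_{n+1}$-action, for $i,j,k\in\{1,\ldots,n\}$ (with $i\ne j$ in the last formula): $h_k\cdot f=h_kf$; $\ e_{i,n+1}\cdot f=(\overline h+b)\,u_i\,\sigma_if$; $\ e_{n+1,j}\cdot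 f=-w_j\,\sigma_j^{-1}f$; $\ e_{i,j}\cdot f=u_iw_j\,\sigma_i\sigma_j^{-1}f$, where $u_i=1$ if $i\in S$, $u_i=h_i-b-1$ if $i\notin S$, and $w_j=h_j-b$ if $j\in S$, $w_j=1$ if $j\notin S$. For an automorphism $\varphi$ of $\mathcal{U}(\mathfrak{sl}_{n+1})$, $F_\varphi$ sends a module to the same vector space with new action $x\bullet v=\varphi(x)\cdot v$. $F_\tau$ corresponds to $\tau(e_{i,j})=-e_{j,i}$; for $a\in(\mathbb{C}^* )^{n+1}$, $F_a$ corresponds to $\varphi_a(e_{i,j})=\frac{a_i}{a_j}e_{i,j}$. A skeleton of $\mathcal{M}$ is a full subcategory such that every object of $\mathcal{M}$ is isomorphic to exactly one of its objects. *)

theory Defs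
  imports "HOL-Analysis.Analysis" "HOL-Library.Poly_Mapping"
begin

section \<open>The Lie algebra\<close>

text \<open>The finite type \<open>'n\<close> plays the role of \<open>{1, \<dots>, n}\<close>, so \<open>n = CARD('n)\<close>. The matrix
  indices \<open>1, \<dots>, n + 1\<close> are the elements of \<open>'n option\<close>: \<open>Some i\<close> is \<open>i\<close> and \<open>None\<close> is \<open>n + 1\<close>.\<close>

type_synonym 'n mat = "complex ^ ('n option) ^ ('n option)"

definition sl :: "'n::finite mat set" where
  "sl = {x. trace x = 0}"

definition bracket :: "'n::finite mat \<Rightarrow> 'n mat \<Rightarrow> 'n mat" where
  "bracket x y = x ** y - y ** x"

definition matrix_unit :: "'n option \<Rightarrow> 'n option \<Rightarrow> 'n::finite mat" where
  "matrix_unit i j = (\<chi> k l. if k = i \<and> l = j then 1 else 0)"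

definition cartan_h :: "'n \<Rightarrow> 'n::finite mat" where
  "cartan_h k = matrix_unit (Some k) (Some k)
     - map_matrix ((*) (1 / of_nat (CARD('n) + 1))) (\<Sum>m\<in>UNIV. matrix_unit m m)"


section \<open>Modules and their morphisms\<close>

text \<open>A module over the enveloping algebra of \<open>sl\<close> is given by the underlying representation of the
  Lie algebra. The action is only meaningful on \<open>sl\<close>; it is required to be extensional, so that
  equality of records is equality of modules.\<close>

record ('n, 'v) slmod =
  smult :: "complex \<Rightarrow> 'v \<Rightarrow> 'v"
  act :: "'n mat \<Rightarrow> 'v \<Rightarrow> 'v"

definition is_slmod :: "('n::finite, 'v::ab_group_add) slmod \<Rightarrow> bool" where
  "is_slmod V \<longleftrightarrow>
     vector_space (smult V) \<and>
     act V \<in> extensional sl \<and>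
     (\<forall>x\<in>sl. Vector_Spaces.linear (smult V) (smult V) (act V x)) \<and>
     (\<forall>x\<in>sl. \<forall>y\<in>sl. \<forall>v. act V (x + y) v = act V x v + act V y v) \<and>
     (\<forall>c. \<forall>x\<in>sl. \<forall>v. act V (map_matrix ((*) c) x) v = smult V c (act V x v)) \<and>
     (\<forall>x\<in>sl. \<forall>y\<in>sl. \<forall>v. act V (bracket x y) v = act V x (act V y v) - act V y (act V x v))"

definition slmod_hom ::
    "('n::finite, 'v::ab_group_add) slmod \<Rightarrow> ('n, 'w::ab_group_add) slmod \<Rightarrow> ('v \<Rightarrow> 'w) \<Rightarrow> bool" where
  "slmod_hom V W f \<longleftrightarrow>
     Vector_Spaces.linear (smult V) (smult W) f \<and>
     (\<forall>x\<in>sl. \<forall>v. f (act V x v) = act W x (f v))"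

definition slmod_iso ::
    "('n::finite, 'v::ab_group_add) slmod \<Rightarrow> ('n, 'w::ab_group_add) slmod \<Rightarrow> bool" where
  "slmod_iso V W \<longleftrightarrow> (\<exists>f. slmod_hom V W f \<and> bij f)"

text \<open>For a Lie algebra automorphism \<open>\<phi>\<close> of \<open>sl\<close>, the functor \<open>F\<^sub>\<phi>\<close> on objects.\<close>

definition twist :: "('n::finite mat \<Rightarrow> 'n mat) \<Rightarrow> ('n, 'v) slmod \<Rightarrow> ('n, 'v) slmod" where
  "twist \<phi> V = V\<lparr>act := (\<lambda>x\<in>sl. act V (\<phi> x))\<rparr>"

definition tau :: "'n::finite mat \<Rightarrow> 'n mat" where
  "tau x = - transpose x"

definition phi :: "('n option \<Rightarrow> complex) \<Rightarrow> 'n::finite mat \<Rightarrow> 'n mat" where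
  "phi a x = (\<chi> i j. a i / a j * x $ i $ j)"

lemma tau_matrix_unit: "tau (matrix_unit i j) = - matrix_unit j i"
  by (auto simp: tau_def matrix_unit_def transpose_def vec_eq_iff)

lemma phi_matrix_unit: "phi a (matrix_unit i j) = map_matrix ((*) (a i / a j)) (matrix_unit i j)"
  by (auto simp: phi_def matrix_unit_def vec_eq_iff)


section \<open>The polynomial ring\<close>

text \<open>Polynomials in the variables \<open>h\<^sub>k\<close>, \<open>k :: 'n\<close>, as finitely supported functions from exponent
  vectors to coefficients.\<close>

type_synonym 'n mpoly = "('n \<Rightarrow>\<^sub>0 nat) \<Rightarrow>\<^sub>0 complex"

definition const :: "complex \<Rightarrow> 'n mpoly" where
  "const c = Poly_Mapping.single 0 c"

definition var :: "'n \<Rightarrow> 'n mpoly" where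
  "var k = Poly_Mapping.single (Poly_Mapping.single k 1) 1"

definition subst :: "('n::finite \<Rightarrow> 'n mpoly) \<Rightarrow> 'n mpoly \<Rightarrow> 'n mpoly" where
  "subst g p = (\<Sum>m\<in>Poly_Mapping.keys p.
     const (Poly_Mapping.lookup p m) * (\<Prod>k\<in>UNIV. g k ^ Poly_Mapping.lookup m k))"

definition sigma :: "'n::finite \<Rightarrow> 'n mpoly \<Rightarrow> 'n mpoly" where
  "sigma i = subst (\<lambda>k. var k - (if i = k then 1 else 0))"

lemma const_add: "const (c + d) = const c + const d"
  by (simp add: const_def single_add)

lemma const_mult: "const (c * d) = const c * const d"
  by (simp add: const_def mult_single)

lemma const_0 [simp]: "const 0 = 0" and const_1 [simp]: "const 1 = 1"
  by (simp_all add: const_def)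

lemma mpoly_induct [case_names single add]:
  fixes p :: "'n mpoly"
  assumes "\<And>m c. P (Poly_Mapping.single m c)" and "\<And>p q. P p \<Longrightarrow> P q \<Longrightarrow> P (p + q)"
  shows "P p"
proof (induction p rule: update_induct)
  case const
  show ?case using assms(1)[of 0 0] by simp
next
  case (update p m c)
  then have "Poly_Mapping.update m c p = p + Poly_Mapping.single m c"
    by (intro poly_mapping_eqI)
       (auto simp: lookup_update lookup_add lookup_single when_def in_keys_iff)
  then show ?case using assms update by simp
qed

lemma subst_single:
  "subst g (Poly_Mapping.single m c) = const c * (\<Prod>k\<in>UNIV. g k ^ Poly_Mapping.lookup m k)"
  by (simp add: subst_def)

lemma subst_superset:
  assumes "finite A" "Poly_Mapping.keys p \<subseteq> A"
  shows "subst g p = (\<Sum>m\<in>A. const (Poly_Mapping.lookup p m) * (\<Prod>k\<in>UNIV. g k ^ Poly_Mapping.lookup m k))"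
  unfolding subst_def using assms by (intro sum.mono_neutral_left) (auto simp: in_keys_iff)

lemma subst_add: "subst g (p + q) = subst g p + subst g q"
proof -
  let ?A = "Poly_Mapping.keys p \<union> Poly_Mapping.keys q"
  have "Poly_Mapping.keys (p + q) \<subseteq> ?A" by (rule keys_add)
  then show ?thesis
    by (simp add: subst_superset[of ?A] lookup_add const_add distrib_right sum.distrib)
qed

lemma subst_mult: "subst g (p * q) = subst g p * subst g q"
proof (induction p rule: mpoly_induct)
  case (single m c)
  show ?case
  proof (induction q rule: mpoly_induct)
    case (single m' c')
    show ?case
      by (simp add: mult_single subst_single const_mult lookup_add power_add prod.distrib mult_ac)
  next
    case (add p q)
    then show ?case by (simp add: distrib_left subst_add)
  qed
next
  case (add p q)
  then show ?case by (simp add: distrib_right subst_add)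
qed

lemma subst_const: "subst g (const c) = const c"
  by (simp add: const_def subst_single)

lemma subst_var: "subst g (var k) = g k"
proof -
  have "(\<Prod>l\<in>UNIV. g l ^ Poly_Mapping.lookup (Poly_Mapping.single k 1) l)
      = (\<Prod>l\<in>UNIV. if l = k then g l else 1)"
    by (intro prod.cong) (auto simp: lookup_single when_def)
  then show ?thesis by (simp add: var_def subst_single)
qed

lemma mpoly_single_eq:
  fixes m :: "'n::finite \<Rightarrow>\<^sub>0 nat"
  shows "Poly_Mapping.single m c = const c * (\<Prod>k\<in>UNIV. var k ^ Poly_Mapping.lookup m k)"
proof -
  have pow: "var k ^ e = Poly_Mapping.single (Poly_Mapping.single k e) 1" for k :: 'n and e
    by (induction e) (simp_all add: var_def mult_single flip: single_add)
  have prod: "(\<Prod>k\<in>A. Poly_Mapping.single (Poly_Mapping.single k (e k)) 1)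
      = (Poly_Mapping.single (\<Sum>k\<in>A. Poly_Mapping.single k (e k)) 1 :: 'n mpoly)"
    if "finite A" for A :: "'n set" and e
    using that by (induction A rule: finite_induct) (simp_all add: mult_single)
  have "(\<Sum>k\<in>UNIV. Poly_Mapping.single k (Poly_Mapping.lookup m k)) = m"
    by (intro poly_mapping_eqI) (simp add: lookup_sum lookup_single when_def)
  then show ?thesis by (simp add: pow prod const_def mult_single)
qed

lemma subst_var_id: "subst var p = p"
  by (induction p rule: mpoly_induct) (simp_all add: subst_single subst_add flip: mpoly_single_eq)

lemma subst_power: "subst g (p ^ e) = subst g p ^ e"
proof (induction e)
  case 0
  show ?case using subst_const[of g 1] by simp
qed (simp add: subst_mult)

lemma subst_prod: "subst g (\<Prod>k\<in>A. f k) = (\<Prod>k\<in>A. subst g (f k))"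
proof (induction A rule: infinite_finite_induct)
  case (insert x F)
  then show ?case by (simp add: subst_mult)
qed (use subst_const[of g 1] in simp_all)

lemma subst_subst: "subst g (subst f p) = subst (\<lambda>k. subst g (f k)) p"
  by (induction p rule: mpoly_induct)
     (simp_all add: subst_single subst_add subst_mult subst_const subst_prod subst_power)

lemma subst_minus: "subst g (- p) = - subst g p"
  by (metis add.right_inverse add_eq_0_iff subst_add subst_const const_0)

lemma sigma_var: "sigma i (var k) = var k - (if i = k then 1 else 0)"
  by (simp add: sigma_def subst_var)

lemma inv_sigma: "inv (sigma i) = subst (\<lambda>k. var k + (if i = k then 1 else 0))"
  and bij_sigma: "bij (sigma i)"
proof -
  let ?s = "subst (\<lambda>k. var k + (if i = k then 1 else 0))"
  have one: "subst g 1 = 1" and zero: "subst g 0 = 0" for g :: "'a \<Rightarrow> 'a mpoly"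
    using subst_const[of g 1] subst_const[of g 0] by simp_all
  have diff: "subst g (p - q) = subst g p - subst g q" for g :: "'a \<Rightarrow> 'a mpoly" and p q
    using subst_add[of g p "- q"] by (simp add: subst_minus)
  have 1: "sigma i (?s p) = p" for p
  proof -
    have "sigma i (?s p) = subst (\<lambda>k. var k) p"
      unfolding sigma_def subst_subst
      by (intro arg_cong[where f = "\<lambda>g. subst g p"] ext) (auto simp: subst_add subst_var one zero)
    then show ?thesis by (simp add: subst_var_id)
  qed
  have 2: "?s (sigma i p) = p" for p
  proof -
    have "?s (sigma i p) = subst (\<lambda>k. var k) p"
      unfolding sigma_def subst_subst
      by (intro arg_cong[where f = "\<lambda>g. subst g p"] ext) (auto simp: diff subst_var one zero)
    then show ?thesis by (simp add: subst_var_id)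
  qed
  show "inv (sigma i) = ?s" using 1 2 by (intro inv_equality) auto
  show "bij (sigma i)" using 1 2 by (intro o_bij[of ?s]) (auto simp: fun_eq_iff)
qed


section \<open>The category\<close>

text \<open>The enveloping algebra of the Cartan subalgebra is the polynomial ring in the \<open>h\<^sub>k\<close>.
  The restriction of \<open>V\<close> to it is the module structure over the polynomial ring in which constants
  act by scalars and \<open>h\<^sub>k\<close> acts as in \<open>V\<close>; there is at most one (lemma \<open>cartan_restriction_unique\<close>).\<close>

definition cartan_restriction ::
    "('n::finite, 'v::ab_group_add) slmod \<Rightarrow> ('n mpoly \<Rightarrow> 'v \<Rightarrow> 'v) \<Rightarrow> bool" where
  "cartan_restriction V pact \<longleftrightarrow>
     module pact \<and>
     (\<forall>c v. pact (const c) v = smult V c v) \<and>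
     (\<forall>k v. pact (var k) v = act V (cartan_h k) v)"

definition free_rank_one :: "('r::comm_ring_1 \<Rightarrow> 'v::ab_group_add \<Rightarrow> 'v) \<Rightarrow> bool" where
  "free_rank_one s \<longleftrightarrow> (\<exists>v. \<not> module.dependent s {v} \<and> module.span s {v} = UNIV)"

definition category_M :: "('n::finite, 'v::ab_group_add) slmod set" where
  "category_M = {V. is_slmod V \<and> (\<exists>pact. cartan_restriction V pact \<and> free_rank_one pact)}"

lemma cartan_restriction_unique:
  assumes s: "cartan_restriction V s" and t: "cartan_restriction V t"
  shows "s = t"
proof -
  interpret s: module s using s by (simp add: cartan_restriction_def)
  interpret t: module t using t by (simp add: cartan_restriction_def)
  have c: "s (const c) v = t (const c) v" and x: "s (var k) v = t (var k) v" for c k v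
    using s t by (simp_all add: cartan_restriction_def)
  have m: "s (p * q) v = t (p * q) v" if "\<And>v. s p v = t p v" "\<And>v. s q v = t q v" for p q v
    using that by (simp flip: s.scale_scale t.scale_scale)
  have pow: "s (var k ^ e) v = t (var k ^ e) v" for k e v
    by (induction e arbitrary: v) (simp_all add: m x)
  have prod: "s (\<Prod>k\<in>A. var k ^ e k) v = t (\<Prod>k\<in>A. var k ^ e k) v" if "finite A" for A e v
    using that by (induction A arbitrary: v rule: finite_induct) (simp_all add: m pow)
  have "s p v = t p v" for p v
    by (induction p rule: mpoly_induct)
       (simp_all add: mpoly_single_eq m c prod s.scale_left_distrib t.scale_left_distrib)
  then show ?thesis by blast
qed


section \<open>The modules \<open>M\<^sub>b\<^sup>S\<close>\<close>

definition hbar :: "'n::finite mpoly" where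
  "hbar = (\<Sum>i\<in>UNIV. var i)"

definition u_poly :: "'n set \<Rightarrow> complex \<Rightarrow> 'n \<Rightarrow> 'n mpoly" where
  "u_poly S b i = (if i \<in> S then 1 else var i - const b - 1)"

definition w_poly :: "'n set \<Rightarrow> complex \<Rightarrow> 'n \<Rightarrow> 'n mpoly" where
  "w_poly S b j = (if j \<in> S then var j - const b else 1)"

text \<open>The action of \<open>e\<^sub>i\<^sub>j\<close> for \<open>i \<noteq> j\<close>; the values for \<open>i = j\<close> are not used.\<close>

fun unit_act :: "'n::finite set \<Rightarrow> complex \<Rightarrow> 'n option \<Rightarrow> 'n option \<Rightarrow> 'n mpoly \<Rightarrow> 'n mpoly" where
  "unit_act S b (Some i) None f = (hbar + const b) * u_poly S b i * sigma i f"
| "unit_act S b None (Some j) f = - w_poly S b j * inv (sigma j) f"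
| "unit_act S b (Some i) (Some j) f = u_poly S b i * w_poly S b j * sigma i (inv (sigma j) f)"
| "unit_act S b None None f = 0"

text \<open>The linear extension to \<open>sl\<close>: a matrix \<open>x\<close> of trace 0 is the combination of the \<open>h\<^sub>k\<close> with
  coefficients \<open>x\<^sub>k\<^sub>k - x\<^sub>n\<^sub>+\<^sub>1\<^sub>,\<^sub>n\<^sub>+\<^sub>1\<close> and of the \<open>e\<^sub>i\<^sub>j\<close>, \<open>i \<noteq> j\<close>, with coefficients \<open>x\<^sub>i\<^sub>j\<close>
  (lemma \<open>sl_basis\<close>).\<close>

definition module_M :: "'n::finite set \<Rightarrow> complex \<Rightarrow> ('n, 'n mpoly) slmod" where
  "module_M S b =
     \<lparr>smult = (\<lambda>c f. const c * f),
      act = (\<lambda>x\<in>sl. \<lambda>f.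
        (\<Sum>k\<in>UNIV. const (x $ Some k $ Some k - x $ None $ None) * (var k * f)) +
        (\<Sum>i\<in>UNIV. \<Sum>j\<in>UNIV - {i}. const (x $ i $ j) * unit_act S b i j f))\<rparr>"

lemma sum_matrix_unit_nth:
  "(\<Sum>m\<in>UNIV. matrix_unit m m) $ i $ j = (if i = j then 1 else (0 :: complex))"
proof -
  have "(\<Sum>m\<in>UNIV. matrix_unit m m) $ i $ j
      = (\<Sum>m\<in>UNIV. if m = i then (if i = j then 1 else (0 :: complex)) else 0)"
    unfolding sum_component by (intro sum.cong) (auto simp: matrix_unit_def)
  then show ?thesis by simp
qed

lemma cartan_h_nth:
  "(cartan_h k :: 'n::finite mat) $ i $ j =
     (if i = j then (if i = Some k then 1 else 0) - 1 / of_nat (CARD('n) + 1) else 0)"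
  unfolding cartan_h_def vector_minus_component nth_map_matrix sum_matrix_unit_nth
  by (auto simp: matrix_unit_def)

lemma sum_UNIV_option: "(\<Sum>i\<in>UNIV. f i) = f None + (\<Sum>k\<in>UNIV. f (Some k))"
  for f :: "'n::finite option \<Rightarrow> 'a::comm_monoid_add"
  by (simp add: UNIV_option_conv sum.reindex)

lemma cartan_h_in_sl: "cartan_h k \<in> sl"
proof -
  have "trace (cartan_h k :: 'a mat)
      = (\<Sum>i\<in>UNIV. if i = Some k then 1 else 0) - (\<Sum>i\<in>(UNIV :: 'a option set). 1 / of_nat (CARD('a) + 1))"
    unfolding trace_def cartan_h_nth by (simp add: sum_subtractf)
  also have "\<dots> = 0" using of_nat_neq_0[of "CARD('a)", where 'a = complex]
    by (simp add: card_UNIV_option)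
  finally show ?thesis by (simp add: sl_def)
qed

lemma matrix_unit_in_sl: "i \<noteq> j \<Longrightarrow> matrix_unit i j \<in> sl"
  by (auto simp: sl_def trace_def matrix_unit_def intro!: sum.neutral)

lemma sl_basis:
  fixes x :: "'n::finite mat"
  assumes "x \<in> sl"
  shows "x = (\<Sum>k\<in>UNIV. map_matrix ((*) (x $ Some k $ Some k - x $ None $ None)) (cartan_h k))
    + (\<Sum>i\<in>UNIV. \<Sum>j\<in>UNIV - {i}. map_matrix ((*) (x $ i $ j)) (matrix_unit i j))"
    (is "x = ?D + ?E")
proof -
  let ?N = "of_nat (CARD('n) + 1) :: complex"
  let ?c = "\<lambda>k. x $ Some k $ Some k - x $ None $ None"
  have N: "?N \<noteq> 0" by (simp del: of_nat_Suc add: of_nat_eq_0_iff)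
  have "x $ None $ None + (\<Sum>k\<in>UNIV. x $ Some k $ Some k) = 0"
    using assms by (simp add: sl_def trace_def sum_UNIV_option)
  then have c: "(\<Sum>k\<in>UNIV. ?c k) = - ?N * x $ None $ None"
    by (simp add: sum_subtractf algebra_simps add_eq_0_iff)
  have E: "?E $ p $ q = (if p = q then 0 else x $ p $ q)" for p q
  proof -
    have "?E $ p $ q = (\<Sum>i\<in>UNIV. \<Sum>j\<in>UNIV - {i}. if i = p then if j = q then x $ p $ q else 0 else 0)"
      unfolding sum_component by (intro sum.cong refl) (auto simp: matrix_unit_def)
    also have "\<dots> = (\<Sum>i\<in>UNIV. if i = p then \<Sum>j\<in>UNIV - {p}. if j = q then x $ p $ q else 0 else 0)"
      by (intro sum.cong) auto
    finally show ?thesis by (auto simp: sum.delta)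
  qed
  have D: "?D $ p $ q = (if p = q then x $ p $ q else 0)" for p q
  proof (cases "p = q")
    case False
    then show ?thesis by (simp add: sum_component cartan_h_nth)
  next
    case True
    have "?D $ p $ p = (\<Sum>k\<in>UNIV. if p = Some k then ?c k else 0) - (\<Sum>k\<in>UNIV. ?c k) / ?N"
      unfolding sum_component nth_map_matrix cartan_h_nth sum_divide_distrib
        sum_subtractf[symmetric]
      by (intro sum.cong) (auto simp: algebra_simps diff_divide_distrib)
    also have "(\<Sum>k\<in>UNIV. ?c k) / ?N = - x $ None $ None"
      unfolding c using N by (simp add: field_simps)
    also have "(\<Sum>k\<in>UNIV. if p = Some k then ?c k else 0) = x $ p $ p - x $ None $ None"
      by (cases p) simp_all
    finally show ?thesis using True by simp
  qed
  show ?thesis by (simp add: vec_eq_iff D E del: sum_component)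
qed

lemma module_M_cartan_h: "act (module_M S b) (cartan_h k) f = var k * f"
proof -
  have "(\<Sum>i\<in>UNIV. const ((cartan_h k $ Some i $ Some i) - cartan_h k $ None $ None) * (var i * f))
      = (\<Sum>i\<in>UNIV. if i = k then var i * f else 0)"
    by (intro sum.cong) (auto simp: cartan_h_nth)
  moreover have "(\<Sum>i\<in>UNIV. \<Sum>j\<in>UNIV - {i}. const (cartan_h k $ i $ j) * unit_act S b i j f) = 0"
    by (intro sum.neutral ballI) (auto simp: cartan_h_nth)
  ultimately show ?thesis by (simp add: module_M_def cartan_h_in_sl)
qed

lemma module_M_matrix_unit:
  assumes "i \<noteq> j"
  shows "act (module_M S b) (matrix_unit i j) f = unit_act S b i j f"
proof -
  let ?e = "matrix_unit i j :: 'a mat"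
  have "(\<Sum>p\<in>UNIV. \<Sum>q\<in>UNIV - {p}. const (?e $ p $ q) * unit_act S b p q f)
      = (\<Sum>p\<in>UNIV. \<Sum>q\<in>UNIV - {p}. if p = i then if q = j then unit_act S b i j f else 0 else 0)"
    by (intro sum.cong refl) (auto simp: matrix_unit_def)
  also have "\<dots> = (\<Sum>p\<in>UNIV. if p = i then \<Sum>q\<in>UNIV - {i}. if q = j then unit_act S b i j f else 0 else 0)"
    by (intro sum.cong refl) auto
  also have "\<dots> = unit_act S b i j f" using assms by (simp add: sum.delta)
  finally have "(\<Sum>p\<in>UNIV. \<Sum>q\<in>UNIV - {p}. const (?e $ p $ q) * unit_act S b p q f)
      = unit_act S b i j f" .
  moreover have "?e $ k $ k = 0" for k using assms by (auto simp: matrix_unit_def)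
  ultimately show ?thesis using assms by (simp add: module_M_def matrix_unit_in_sl)
qed


section \<open>The skeleton\<close>

definition category_S :: "('n::finite, 'n mpoly) slmod set" where
  "category_S =
     {twist (phi a) (module_M S b) | a S b. (\<forall>i. a i \<noteq> 0) \<and> a None = 1} \<union>
     {twist (phi a) (twist tau (module_M S b)) | a S b. (\<forall>i. a i \<noteq> 0) \<and> a None = 1}"

end

theory Submission
  imports Defs "HOL-Computational_Algebra.Fundamental_Theorem_Algebra"
begin

text \<open>On a module \<open>V\<close> in \<open>\<M>\<close>, identified with the polynomial ring, \<open>e\<^sub>i\<^sub>j\<close> acts as
  \<open>f \<mapsto> P\<^sub>i\<^sub>j \<sigma>\<^sub>i\<sigma>\<^sub>j\<^sup>-\<^sup>1 f\<close>, and an isomorphism can only multiply by a unit, that is a nonzero scalar;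
  so \<open>V\<close> up to isomorphism is the family \<open>P\<close>. It is determined by
  \<open>p\<^sub>i = P\<^sub>i\<^sub>,\<^sub>n\<^sub>+\<^sub>1\<close> and \<open>q\<^sub>i = P\<^sub>n\<^sub>+\<^sub>1\<^sub>,\<^sub>i\<close>. The relation for \<open>[e\<^sub>i\<^sub>,\<^sub>n\<^sub>+\<^sub>1, e\<^sub>n\<^sub>+\<^sub>1\<^sub>,\<^sub>i]\<close> shows that
  \<open>q\<^sub>i \<sigma>\<^sub>i\<^sup>-\<^sup>1 p\<^sub>i\<close> is quadratic in \<open>h\<^sub>i\<close> with leading coefficient \<open>-1\<close>. Hence either one of \<open>p\<^sub>i\<close>, \<open>q\<^sub>i\<close> is a
  constant, or \<open>p\<^sub>i = a (h\<^sub>i + r)\<close> and \<open>q\<^sub>i = - (h\<^sub>i + s) / a\<close> with \<open>r + s = \<Sum>\<^bsub>k \<noteq> i\<^esub> h\<^sub>k\<close>. In the last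
  case commutation with \<open>p\<^sub>j\<close> makes \<open>r - \<sigma>\<^sub>j r\<close> the degree of \<open>p\<^sub>j\<close> in \<open>h\<^sub>i\<close>, a natural number, and
  dually for \<open>s\<close>, so for each \<open>j\<close> exactly one of \<open>r\<close>, \<open>s\<close> contains \<open>h\<^sub>j\<close>. The remaining relations
  show that the choice is the same for all pairs; up to \<open>\<tau>\<close>, which exchanges the \<open>p\<^sub>i\<close> and the \<open>q\<^sub>i\<close>,
  every \<open>p\<^sub>i\<close> depends on all the variables, and comparing coefficients leaves \<open>F\<^sub>a(M\<^sub>b\<^sup>S)\<close>, where \<open>S\<close>
  is the set of the \<open>i\<close> such that \<open>q\<^sub>i\<close> is not constant.\<close>

section \<open>Evaluation of polynomials\<close>

text \<open>Substituting constants leaves a constant polynomial, and its coefficient at the exponent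
  \<open>0\<close> is the value. With this encoding the evaluation laws come from the laws of
  \<open>subst\<close>.\<close>

definition eval_mpoly :: "'n::finite mpoly \<Rightarrow> ('n \<Rightarrow> complex) \<Rightarrow> complex" where
  "eval_mpoly p x = Poly_Mapping.lookup (subst (\<lambda>k. const (x k)) p) 0"

lemma const_inject: "const c = const d \<longleftrightarrow> c = d"
  unfolding const_def by (metis lookup_single_eq)

lemma const_power: "const (c ^ e) = const c ^ e"
  by (induction e) (simp_all add: const_mult)

lemma const_prod: "const (\<Prod>k\<in>A. f k) = (\<Prod>k\<in>A. const (f k))"
  by (induction A rule: infinite_finite_induct) (simp_all add: const_mult)

lemma const_sum: "const (\<Sum>k\<in>A. f k) = (\<Sum>k\<in>A. const (f k))"
  by (induction A rule: infinite_finite_induct) (simp_all add: const_add)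

lemma subst_const_eq: "subst (\<lambda>k. const (x k)) p = const (eval_mpoly p x)"
proof -
  have "\<exists>c. subst (\<lambda>k. const (x k)) p = const c"
  proof (induction p rule: mpoly_induct)
    case (single m c)
    then show ?case
      by (auto simp: subst_single simp flip: const_power const_prod const_mult)
  next
    case (add p q)
    then show ?case by (auto simp: subst_add simp flip: const_add)
  qed
  then show ?thesis by (auto simp: eval_mpoly_def) (simp add: const_def)
qed

lemma eval_mpoly_eqI: "subst (\<lambda>k. const (x k)) p = const c \<Longrightarrow> eval_mpoly p x = c"
  by (simp add: subst_const_eq const_inject)

lemma eval_single [simp]:
  "eval_mpoly (Poly_Mapping.single m c) x = c * (\<Prod>k\<in>UNIV. x k ^ Poly_Mapping.lookup m k)"
  by (rule eval_mpoly_eqI) (simp add: subst_single const_power const_prod const_mult)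

lemma eval_add [simp]: "eval_mpoly (p + q) x = eval_mpoly p x + eval_mpoly q x"
  by (rule eval_mpoly_eqI) (simp only: const_add subst_add subst_const_eq[symmetric])

lemma eval_mult [simp]: "eval_mpoly (p * q) x = eval_mpoly p x * eval_mpoly q x"
  by (rule eval_mpoly_eqI) (simp only: const_mult subst_mult subst_const_eq[symmetric])

lemma eval_const [simp]: "eval_mpoly (const c) x = c"
  by (rule eval_mpoly_eqI) (simp add: subst_const)

lemma eval_var [simp]: "eval_mpoly (var k) x = x k"
  by (rule eval_mpoly_eqI) (simp add: subst_var)

lemma eval_0 [simp]: "eval_mpoly 0 x = 0" and eval_1 [simp]: "eval_mpoly 1 x = 1"
  using eval_const[of 0 x] eval_const[of 1 x] by simp_all

lemma eval_uminus [simp]: "eval_mpoly (- p) x = - eval_mpoly p x"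
  by (metis add.right_inverse eval_add eval_0 add_eq_0_iff)

lemma eval_diff [simp]: "eval_mpoly (p - q) x = eval_mpoly p x - eval_mpoly q x"
  using eval_add[of p "- q" x] by simp

lemma eval_sum [simp]: "eval_mpoly (\<Sum>i\<in>A. p i) x = (\<Sum>i\<in>A. eval_mpoly (p i) x)"
  by (induction A rule: infinite_finite_induct) simp_all

lemma eval_subst [simp]: "eval_mpoly (subst g p) x = eval_mpoly p (\<lambda>k. eval_mpoly (g k) x)"
proof -
  have "subst (\<lambda>k. const (x k)) (subst g p) = subst (\<lambda>k. const (eval_mpoly (g k) x)) p"
    unfolding subst_subst by (simp add: subst_const_eq)
  then show ?thesis by (simp add: subst_const_eq const_inject)
qed

text \<open>Induction on the set \<open>A\<close> of variables. With the other variables frozen, the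
  sum is a univariate polynomial in the new one that vanishes everywhere, so each of its
  coefficients vanishes. The coefficient of degree \<open>e m a\<close> is a sum of the same shape
  over those exponents of \<open>M\<close> that agree with \<open>m\<close> at \<open>a\<close>, and
  these are still separated by \<open>A\<close>.\<close>

lemma coefficients_zero:
  fixes c :: "'m \<Rightarrow> complex" and e :: "'m \<Rightarrow> 'n \<Rightarrow> nat"
  assumes "finite A" "finite M"
    and "\<And>m m'. m \<in> M \<Longrightarrow> m' \<in> M \<Longrightarrow> (\<And>k. k \<in> A \<Longrightarrow> e m k = e m' k) \<Longrightarrow> m = m'"
    and "\<And>x. (\<Sum>m\<in>M. c m * (\<Prod>k\<in>A. x k ^ e m k)) = 0"
    and "m \<in> M"
  shows "c m = 0"
  using assms
proof (induction A arbitrary: M m rule: finite_induct)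
  case empty
  then have "M = {m}" by auto
  with empty.prems(3) show ?case by simp
next
  case (insert a A)
  let ?M = "{m' \<in> M. e m' a = e m a}"
  show ?case
  proof (rule insert.IH)
    show "finite ?M" "m \<in> ?M" using insert.prems by auto
  next
    fix m1 m2 assume "m1 \<in> ?M" "m2 \<in> ?M" and "\<And>k. k \<in> A \<Longrightarrow> e m1 k = e m2 k"
    then show "m1 = m2" by (intro insert.prems(2)) auto
  next
    fix x :: "'n \<Rightarrow> complex"
    let ?q = "\<Sum>m\<in>M. monom (c m * (\<Prod>k\<in>A. x k ^ e m k)) (e m a)"
    have "poly ?q t = 0" for t
    proof -
      have "poly ?q t = (\<Sum>m\<in>M. c m * (\<Prod>k\<in>insert a A. (x(a := t)) k ^ e m k))"
        unfolding poly_sum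
      proof (intro sum.cong refl)
        fix m
        have "(\<Prod>k\<in>A. (x(a := t)) k ^ e m k) = (\<Prod>k\<in>A. x k ^ e m k)"
          using insert.hyps by (intro prod.cong) auto
        then show "poly (monom (c m * (\<Prod>k\<in>A. x k ^ e m k)) (e m a)) t
            = c m * (\<Prod>k\<in>insert a A. (x(a := t)) k ^ e m k)"
          using insert.hyps by (simp add: poly_monom)
      qed
      then show ?thesis using insert.prems(3) by simp
    qed
    then have "?q = 0" using poly_all_0_iff_0 by blast
    then have "0 = coeff ?q (e m a)" by simp
    also have "\<dots> = (\<Sum>m'\<in>M. if e m' a = e m a then c m' * (\<Prod>k\<in>A. x k ^ e m' k) else 0)"
      unfolding coeff_sum by (intro sum.cong) auto
    also have "\<dots> = (\<Sum>m\<in>?M. c m * (\<Prod>k\<in>A. x k ^ e m k))"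
      using insert.prems(1) by (simp add: sum.inter_filter)
    finally show "(\<Sum>m\<in>?M. c m * (\<Prod>k\<in>A. x k ^ e m k)) = 0" by simp
  qed
qed

lemma eval_eq_0_imp: 
  assumes "\<And>x. eval_mpoly p x = 0"
  shows "p = (0 :: 'n::finite mpoly)"
proof (rule poly_mapping_eqI)
  fix m
  have sum: "eval_mpoly p x = (\<Sum>m\<in>Poly_Mapping.keys p. Poly_Mapping.lookup p m * (\<Prod>k\<in>UNIV. x k ^ Poly_Mapping.lookup m k))" for x
    by (rule eval_mpoly_eqI) (simp add: subst_def const_power const_prod const_mult const_sum)
  show "Poly_Mapping.lookup p m = Poly_Mapping.lookup 0 m"
  proof (cases "m \<in> Poly_Mapping.keys p")
    case True
    have "Poly_Mapping.lookup p m = 0"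
      by (rule coefficients_zero[where A = UNIV and M = "Poly_Mapping.keys p" and e = Poly_Mapping.lookup])
        (use True assms sum in \<open>auto intro!: poly_mapping_eqI\<close>)
    then show ?thesis by simp
  qed (simp add: in_keys_iff)
qed

text \<open>The complex field is infinite, so polynomial identities may be checked
  pointwise.\<close>

lemma mpoly_eqI:
  assumes "\<And>x. eval_mpoly p x = eval_mpoly q x"
  shows "p = (q :: 'n::finite mpoly)"
  using eval_eq_0_imp[of "p - q"] assms by simp

section \<open>The ring of polynomial functions\<close>

definition polyfun :: "(('n::finite \<Rightarrow> complex) \<Rightarrow> complex) \<Rightarrow> bool" where
  "polyfun f \<longleftrightarrow> (\<exists>p. f = eval_mpoly p)"

lemma polyfun_eval [intro, simp]: "polyfun (eval_mpoly p)"
  by (auto simp: polyfun_def)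

lemma polyfun_const [intro, simp]: "polyfun (\<lambda>x. c)"
  unfolding polyfun_def by (rule exI[of _ "const c"]) auto

lemma polyfun_var [intro, simp]: "polyfun (\<lambda>x. x i)"
  unfolding polyfun_def by (rule exI[of _ "var i"]) auto

lemma polyfun_add [intro, simp]: "polyfun f \<Longrightarrow> polyfun g \<Longrightarrow> polyfun (\<lambda>x. f x + g x)"
  unfolding polyfun_def by (elim exE, rule_tac x = "p + pa" in exI) auto

lemma polyfun_mult [intro, simp]: "polyfun f \<Longrightarrow> polyfun g \<Longrightarrow> polyfun (\<lambda>x. f x * g x)"
  unfolding polyfun_def by (elim exE, rule_tac x = "p * pa" in exI) auto

lemma polyfun_diff [intro, simp]: "polyfun f \<Longrightarrow> polyfun g \<Longrightarrow> polyfun (\<lambda>x. f x - g x)"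
  unfolding polyfun_def by (elim exE, rule_tac x = "p - pa" in exI) auto

lemma polyfun_uminus [intro, simp]: "polyfun f \<Longrightarrow> polyfun (\<lambda>x. - f x)"
  using polyfun_diff[of "\<lambda>x. 0" f] by simp

lemma polyfun_sum [intro]: "(\<And>i. i \<in> A \<Longrightarrow> polyfun (f i)) \<Longrightarrow> polyfun (\<lambda>x. \<Sum>i\<in>A. f i x)"
  by (induction A rule: infinite_finite_induct) auto

lemma polyfun_prod [intro]: "(\<And>i. i \<in> A \<Longrightarrow> polyfun (f i)) \<Longrightarrow> polyfun (\<lambda>x. \<Prod>i\<in>A. f i x)"
  by (induction A rule: infinite_finite_induct) auto

lemma polyfun_power [intro]: "polyfun f \<Longrightarrow> polyfun (\<lambda>x. f x ^ k)"
  by (induction k) auto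

lemma polyfun_compose:
  fixes g :: "('n::finite \<Rightarrow> complex) \<Rightarrow> 'n \<Rightarrow> complex"
  assumes "polyfun f" "\<And>k. polyfun (\<lambda>x. g x k)"
  shows "polyfun (\<lambda>x. f (g x))"
proof -
  obtain p where p: "f = eval_mpoly p" using assms(1) by (auto simp: polyfun_def)
  obtain h where h: "\<And>k. (\<lambda>x. g x k) = eval_mpoly (h k)"
    using assms(2) unfolding polyfun_def by metis
  have "(\<lambda>x. f (g x)) = eval_mpoly (subst h p)"
    unfolding p by (rule ext) (simp add: h[symmetric])
  then show ?thesis by (auto simp: polyfun_def)
qed

lemma polyfun_if [intro]: "polyfun f \<Longrightarrow> polyfun g \<Longrightarrow> polyfun (\<lambda>x. if c then f x else g x)"
  by (cases c) simp_all

lemma polyfun_upd [intro]: "polyfun f \<Longrightarrow> polyfun (\<lambda>x. f (x(i := x i + c)))"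
  by (erule polyfun_compose) (auto simp: fun_upd_def)

lemma polyfun_upd_diff [intro]: "polyfun f \<Longrightarrow> polyfun (\<lambda>x. f (x(i := x i - c)))"
  using polyfun_upd[of f i "- c"] by simp

text \<open>Restriction to a line makes the theory of univariate polynomials, including the
  fundamental theorem of algebra, available in several variables.\<close>

lemma polyfun_line:
  assumes "polyfun f"
  shows "\<exists>q. \<forall>t. poly q t = f (\<lambda>k. x k + t * y k)"
proof -
  obtain p where p: "f = eval_mpoly p" using assms by (auto simp: polyfun_def)
  have "\<exists>q. \<forall>t. poly q t = eval_mpoly p (\<lambda>k. x k + t * y k)"
  proof (induction p rule: mpoly_induct)
    case (single m c)
    show ?case
      by (rule exI[of _ "[:c:] * (\<Prod>k\<in>UNIV. [:x k, y k:] ^ Poly_Mapping.lookup m k)"])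
        (simp add: poly_prod)
  next
    case (add p q)
    then obtain p' q' where "\<And>t. poly p' t = eval_mpoly p (\<lambda>k. x k + t * y k)"
      "\<And>t. poly q' t = eval_mpoly q (\<lambda>k. x k + t * y k)" by blast
    then show ?case by (intro exI[of _ "p' + q'"]) simp
  qed
  then show ?thesis using p by auto
qed

text \<open>The ring is a domain: if \<open>f\<close> is nonzero at \<open>x\<close> and
  \<open>g\<close> at \<open>y\<close>, both restrict to nonzero univariate polynomials on the line
  through \<open>x\<close> and \<open>y\<close>, while their product restricts to zero.\<close>

lemma polyfun_mult_eq_0:
  assumes f: "polyfun f" and g: "polyfun g" and "\<And>x. f x * g x = 0"
  shows "(\<forall>x. f x = 0) \<or> (\<forall>x. g x = 0)"
proof (rule ccontr)
  assume "\<not> ?thesis"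
  then obtain x y where xy: "f x \<noteq> 0" "g y \<noteq> 0" by auto
  let ?l = "\<lambda>t k. x k + t * (y k - x k)"
  obtain p where p: "\<And>t. poly p t = f (?l t)" using polyfun_line[OF f, of x "\<lambda>k. y k - x k"] by blast
  obtain q where q: "\<And>t. poly q t = g (?l t)" using polyfun_line[OF g, of x "\<lambda>k. y k - x k"] by blast
  have "poly (p * q) t = 0" for t by (simp add: p q assms(3))
  then have "p * q = 0" using poly_all_0_iff_0 by blast
  moreover have "poly p 0 \<noteq> 0" "poly q 1 \<noteq> 0" using xy by (simp_all add: p q)
  ultimately show False by auto
qed

lemma polyfun_mult_cancel:
  assumes "polyfun f" "polyfun g" "polyfun h" "f x0 \<noteq> 0" "\<And>x. f x * g x = f x * h x"
  shows "g x = h x"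
  using polyfun_mult_eq_0[of f "\<lambda>x. g x - h x"] assms by (auto simp: algebra_simps)

lemma polyfun_prod_eq_0:
  assumes "finite A" "\<And>i. i \<in> A \<Longrightarrow> polyfun (f i)" "\<And>x. (\<Prod>i\<in>A. f i x) = 0"
  shows "\<exists>i\<in>A. \<forall>x. f i x = 0"
  using assms
proof (induction A rule: finite_induct)
  case (insert a A)
  have "(\<forall>x. f a x = 0) \<or> (\<forall>x. (\<Prod>i\<in>A. f i x) = 0)"
    using insert by (intro polyfun_mult_eq_0 polyfun_prod) auto
  then show ?case using insert by auto
qed simp

text \<open>Units are constants: a polynomial without zeros on the complex line joining
  \<open>x\<close> and \<open>y\<close> is constant there.\<close>

lemma polyfun_nonzero_const:
  assumes f: "polyfun f" and nz: "\<And>x. f x \<noteq> 0"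
  shows "f x = f y"
proof -
  let ?l = "\<lambda>t k. x k + t * (y k - x k)"
  obtain p where p: "\<And>t. poly p t = f (?l t)" using polyfun_line[OF f, of x "\<lambda>k. y k - x k"] by blast
  have "constant (poly p)"
    using fundamental_theorem_of_algebra[of p] nz by (auto simp: p)
  then have "poly p 0 = poly p 1" unfolding constant_def by blast
  then show ?thesis by (simp add: p)
qed

text \<open>The polynomial takes the value \<open>poly q 0\<close> at every natural number, and
  \<open>q - [:poly q 0:]\<close> would have infinitely many roots if it were nonzero.\<close>

lemma poly_shift_invariant:
  fixes q :: "complex poly"
  assumes "\<And>t. poly q (t - 1) = poly q t"
  shows "poly q t = poly q 0"
proof -
  have n: "poly q (of_nat n) = poly q 0" for n
  proof (induction n)
    case (Suc n)
    then show ?case using assms[of "of_nat (Suc n)"] by simp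
  qed simp
  have "q - [:poly q 0:] = 0"
  proof (rule ccontr)
    assume "q - [:poly q 0:] \<noteq> 0"
    then have "finite {t. poly (q - [:poly q 0:]) t = 0}" by (rule poly_roots_finite)
    then have "finite (range (of_nat :: nat \<Rightarrow> complex))"
      by (rule finite_subset[rotated]) (auto simp: n)
    then show False using finite_imageD[OF _ inj_of_nat] infinite_UNIV_nat by blast
  qed
  then have "poly (q - [:poly q 0:]) t = 0" by simp
  then show ?thesis by simp
qed

text \<open>Invariance under one unit shift already means independence of the variable. The
  commutation relations produce such shift identities, and this turns them into statements about
  which variables occur.\<close>

lemma polyfun_invariant:
  assumes f: "polyfun f" and inv: "\<And>x. f (x(i := x i - 1)) = f x"
  shows "f (x(i := t)) = f x"
proof -
  have l: "(\<lambda>k. (x(i := 0)) k + t * (if k = i then 1 else 0)) = x(i := t)" for t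
    by auto
  obtain p where p: "\<And>t. poly p t = f (\<lambda>k. (x(i := 0)) k + t * (if k = i then 1 else 0))"
    using polyfun_line[OF f, of "x(i := 0)" "\<lambda>k. if k = i then 1 else 0"] by blast
  have p: "poly p t = f (x(i := t))" for t using p[of t] unfolding l .
  have "poly p (t - 1) = poly p t" for t
    using inv[of "x(i := t)"] by (simp add: p)
  then have "poly p t = poly p (x i)"
    using poly_shift_invariant by metis
  then show ?thesis by (simp add: p)
qed

text \<open>A polynomial function seen as a polynomial in the single variable \<open>i\<close>, with
  coefficients polynomial in the base point. The bound \<open>N\<close> is uniform in
  \<open>x\<close>, so only finitely many degrees can occur.\<close>

lemma polyfun_univariate:
  assumes "polyfun f"
  obtains A N where "\<And>x t. poly (A x) t = f (x(i := t))"
    "\<And>k. polyfun (\<lambda>x. coeff (A x) k)" "\<And>x. degree (A x) \<le> N"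
proof -
  obtain p where p: "f = eval_mpoly p" using assms by (auto simp: polyfun_def)
  have "\<exists>A N. (\<forall>x t. poly (A x) t = eval_mpoly p (x(i := t)))
    \<and> (\<forall>k. polyfun (\<lambda>x. coeff (A x) k)) \<and> (\<forall>x. degree (A x) \<le> N)"
  proof (induction p rule: mpoly_induct)
    case (single m c)
    let ?c = "\<lambda>x. c * (\<Prod>k\<in>UNIV - {i}. x k ^ Poly_Mapping.lookup m k)"
    have "poly (monom (?c x) (Poly_Mapping.lookup m i)) t = eval_mpoly (Poly_Mapping.single m c) (x(i := t))" for x t
    proof -
      have "(\<Prod>k\<in>UNIV - {i}. (x(i := t)) k ^ Poly_Mapping.lookup m k) = (\<Prod>k\<in>UNIV - {i}. x k ^ Poly_Mapping.lookup m k)"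
        by (intro prod.cong) auto
      then show ?thesis
        by (simp add: poly_monom prod.remove[of UNIV i])
    qed
    moreover have "polyfun (\<lambda>x. coeff (monom (?c x) (Poly_Mapping.lookup m i)) k)" for k
      by (cases "k = Poly_Mapping.lookup m i") (auto intro!: polyfun_mult polyfun_prod polyfun_power)
    moreover have "degree (monom (?c x) (Poly_Mapping.lookup m i)) \<le> Poly_Mapping.lookup m i" for x
      by (rule degree_monom_le)
    ultimately show ?case
      by (intro exI[of _ "\<lambda>x. monom (?c x) (Poly_Mapping.lookup m i)"] exI[of _ "Poly_Mapping.lookup m i"]) auto
  next
    case (add p q)
    then obtain A N B N' where
      "(\<forall>x t. poly (A x) t = eval_mpoly p (x(i := t)))" "\<forall>k. polyfun (\<lambda>x. coeff (A x) k)" "\<forall>x. degree (A x) \<le> N"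
      "(\<forall>x t. poly (B x) t = eval_mpoly q (x(i := t)))" "\<forall>k. polyfun (\<lambda>x. coeff (B x) k)" "\<forall>x. degree (B x) \<le> N'"
      by blast
    then show ?case
      by (intro exI[of _ "\<lambda>x. A x + B x"] exI[of _ "max N N'"])
        (auto intro!: degree_add_le intro: order_trans simp del: fun_upd_apply)
  qed
  then show ?thesis using that p by auto
qed

section \<open>Weight systems\<close>

text \<open>The effect of \<open>sigma i\<close> followed by the inverse of \<open>sigma j\<close>
  on the argument of a polynomial; the index \<open>None\<close> shifts nothing.\<close>

definition shift :: "'n option \<Rightarrow> 'n option \<Rightarrow> ('n \<Rightarrow> complex) \<Rightarrow> 'n \<Rightarrow> complex" where
  "shift i j x = (\<lambda>k. x k - (if i = Some k then 1 else 0) + (if j = Some k then 1 else 0))"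

definition total :: "('n::finite \<Rightarrow> complex) \<Rightarrow> complex" where
  "total x = (\<Sum>k\<in>UNIV. x k)"

lemma total_upd: "total (x(i := t)) = total x - x i + t"
  by (simp add: total_def sum.remove[of UNIV i])

lemma total_uminus: "total (\<lambda>k. - x k) = - total x"
  by (simp add: total_def sum_negf)

lemma polyfun_total [intro, simp]: "polyfun total"
  unfolding total_def by (auto intro!: polyfun_sum)

text \<open>The weight of the traceless part of the diagonal matrix unit at \<open>i\<close>. These
  parts sum to zero over all n + 1 indices, hence the value \<open>- total x\<close> at
  \<open>None\<close>.\<close>

definition coord :: "('n::finite \<Rightarrow> complex) \<Rightarrow> 'n option \<Rightarrow> complex" where
  "coord x i = (case i of Some k \<Rightarrow> x k | None \<Rightarrow> - total x)"

definition negate :: "'n::finite mpoly \<Rightarrow> 'n mpoly" where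
  "negate = subst (\<lambda>k. - var k)"

definition dual :: "('n::finite option \<Rightarrow> 'n option \<Rightarrow> 'n mpoly) \<Rightarrow> 'n option \<Rightarrow> 'n option \<Rightarrow> 'n mpoly" where
  "dual P i j = - negate (P j i)"

lemma eval_negate [simp]: "eval_mpoly (negate p) x = eval_mpoly p (\<lambda>k. - x k)"
  by (simp add: negate_def)

lemma eval_dual [simp]: "eval_mpoly (dual P i j) x = - eval_mpoly (P j i) (\<lambda>k. - x k)"
  by (simp add: dual_def)

lemma negate_negate [simp]: "negate (negate p) = p"
  by (rule mpoly_eqI) simp

lemma dual_dual [simp]: "dual (dual P) = P"
  by (intro ext mpoly_eqI) simp

text \<open>\<open>P i j\<close> is the image of \<open>1\<close> under \<open>e\<^sub>i\<^sub>j\<close>; the values for \<open>i = j\<close> are junk. \<open>dual\<close> corresponds to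
  \<open>F\<^sub>\<tau>\<close>, and \<open>up P i\<close>, \<open>dn P i\<close> below are the \<open>p\<^sub>i\<close>, \<open>q\<^sub>i\<close> of the introduction.\<close>

locale weight_system =
  fixes P :: "'n::finite option \<Rightarrow> 'n option \<Rightarrow> 'n mpoly"
  assumes commutator: "\<And>i j k l x. i \<noteq> j \<Longrightarrow> k \<noteq> l \<Longrightarrow>
    eval_mpoly (P i j) x * eval_mpoly (P k l) (shift i j x)
      - eval_mpoly (P k l) x * eval_mpoly (P i j) (shift k l x)
    = (if j = k \<and> i = l then coord x i - coord x j
       else if j = k then eval_mpoly (P i l) x
       else if i = l then - eval_mpoly (P k j) x else 0)"

lemma shift_uminus: "(\<lambda>k. - shift i j x k) = shift j i (\<lambda>k. - x k)"
  by (auto simp: shift_def)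

lemma coord_uminus: "coord (\<lambda>k. - x k) i = - coord x i"
  by (cases i) (auto simp: coord_def total_uminus)

text \<open>Negating the point reverses every shift and changes the sign of \<open>coord\<close>, so
  the relation for \<open>i j k l\<close> becomes the one of \<open>P\<close> for
  \<open>j i l k\<close>.\<close>

lemma weight_system_dual:
  assumes "weight_system P"
  shows "weight_system (dual P)"
proof
  interpret weight_system P by fact
  fix i j k l :: "'a option" and x
  assume "i \<noteq> j" "k \<noteq> l"
  then show "eval_mpoly (dual P i j) x * eval_mpoly (dual P k l) (shift i j x)
      - eval_mpoly (dual P k l) x * eval_mpoly (dual P i j) (shift k l x)
    = (if j = k \<and> i = l then coord x i - coord x j
       else if j = k then eval_mpoly (dual P i l) x
       else if i = l then - eval_mpoly (dual P k j) x else 0)"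
    using commutator[of j i l k "\<lambda>k. - x k"]
    by (auto simp: shift_uminus coord_uminus)
qed

definition up :: "('n::finite option \<Rightarrow> 'n option \<Rightarrow> 'n mpoly) \<Rightarrow> 'n \<Rightarrow> ('n \<Rightarrow> complex) \<Rightarrow> complex" where
  "up P i = eval_mpoly (P (Some i) None)"

definition dn :: "('n::finite option \<Rightarrow> 'n option \<Rightarrow> 'n mpoly) \<Rightarrow> 'n \<Rightarrow> ('n \<Rightarrow> complex) \<Rightarrow> complex" where
  "dn P i = eval_mpoly (P None (Some i))"


lemma up_dual: "up (dual P) i x = - dn P i (\<lambda>k. - x k)"
  and dn_dual: "dn (dual P) i x = - up P i (\<lambda>k. - x k)"
  by (simp_all add: up_def dn_def)

lemma shift_Some_None: "shift (Some i) None x = x(i := x i - 1)"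
  and shift_None_Some: "shift None (Some j) x = x(j := x j + 1)"
  and shift_Some_Some: "i \<noteq> j \<Longrightarrow> shift (Some i) (Some j) x = x(i := x i - 1, j := x j + 1)"
  by (auto simp: shift_def)

lemmas shift_simps = shift_Some_None shift_None_Some shift_Some_Some

text \<open>For polynomial functions this says that the variable \<open>j\<close> does not occur in
  \<open>f\<close>; see \<open>polyfun_invariant\<close>.\<close>

definition inv_in :: "(('n \<Rightarrow> complex) \<Rightarrow> complex) \<Rightarrow> 'n \<Rightarrow> bool" where
  "inv_in f j \<longleftrightarrow> (\<forall>x. f (x(j := x j - 1)) = f x)"

definition dn_const where
  "dn_const P i \<longleftrightarrow> (\<exists>c. c \<noteq> 0 \<and> (\<forall>x. dn P i x = c))"

definition up_const where
  "up_const P i \<longleftrightarrow> (\<exists>c. c \<noteq> 0 \<and> (\<forall>x. up P i x = c))"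

text \<open>The case in which \<open>up P i\<close> and \<open>dn P i\<close> both have degree one
  in the variable \<open>i\<close>: the functions \<open>r\<close> and \<open>s\<close> are free of
  it and share out the other variables between them.\<close>

definition linear_at where
  "linear_at P i a r s \<longleftrightarrow> a \<noteq> 0 \<and> polyfun r \<and> polyfun s \<and>
     (\<forall>x t. r (x(i := t)) = r x) \<and> (\<forall>x t. s (x(i := t)) = s x) \<and>
     (\<forall>x. up P i x = a * (x i + r x)) \<and> (\<forall>x. dn P i x = - (x i + s x) / a) \<and>
     (\<forall>x. r x + s x = total x - x i)"

lemma polyfun_negate: "polyfun f \<Longrightarrow> polyfun (\<lambda>x. f (\<lambda>k. - x k))"
  by (erule polyfun_compose) auto

lemma upd_uminus: "(\<lambda>k. - (x(i := t)) k) = (\<lambda>k. - x k)(i := - t)"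
  by auto

lemma linear_at_dual:
  assumes "linear_at P i a r s"
  shows "linear_at (dual P) i (- 1 / a) (\<lambda>x. - s (\<lambda>k. - x k)) (\<lambda>x. - r (\<lambda>k. - x k))"
proof -
  have eq: "\<forall>x. - s (\<lambda>k. - x k) + - r (\<lambda>k. - x k) = total x - x i"
  proof
    fix x
    have "r (\<lambda>k. - x k) + s (\<lambda>k. - x k) = - total x - - x i"
      using assms by (simp add: linear_at_def total_uminus)
    then show "- s (\<lambda>k. - x k) + - r (\<lambda>k. - x k) = total x - x i" by algebra
  qed
  show ?thesis
    unfolding linear_at_def up_dual dn_dual upd_uminus
    by (intro conjI eq)
      (use assms in \<open>auto simp: linear_at_def field_simps intro!: polyfun_negate\<close>)
qed

lemma inv_in_negate:
  fixes f :: "('b \<Rightarrow> complex) \<Rightarrow> complex"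
  shows "inv_in (\<lambda>x. - f (\<lambda>k. - x k)) j \<longleftrightarrow> inv_in f j"
proof -
  have "inv_in (\<lambda>x. - f (\<lambda>k. - x k)) j" if "inv_in f j" for f :: "('b \<Rightarrow> complex) \<Rightarrow> complex"
    unfolding inv_in_def upd_uminus
  proof
    fix x :: "'b \<Rightarrow> complex"
    let ?y = "(\<lambda>k. - x k)(j := - (x j - 1))"
    have "f (?y(j := ?y j - 1)) = f ?y" using that unfolding inv_in_def by blast
    moreover have "?y(j := ?y j - 1) = (\<lambda>k. - x k)" by auto
    ultimately show "- f ?y = - f (\<lambda>k. - x k)" by simp
  qed
  from this[of f] this[of "\<lambda>x. - f (\<lambda>k. - x k)"] show ?thesis by auto
qed

text \<open>The two top terms of the expansion of A(t - 1). The number \<open>Suc m\<close> only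
  bounds the degree, so that the induction over \<open>pCons\<close> can pass to
  \<open>m - 1\<close>.\<close>

lemma coeff_pcompose_shift:
  fixes A :: "complex poly"
  assumes "degree A \<le> Suc m"
  shows "coeff (A \<circ>\<^sub>p [:-1, 1:]) (Suc m) = coeff A (Suc m)
    \<and> coeff (A \<circ>\<^sub>p [:-1, 1:]) m = coeff A m - of_nat (Suc m) * coeff A (Suc m)"
  using assms
proof (induction A arbitrary: m)
  case (pCons a A)
  let ?B = "A \<circ>\<^sub>p [:-1, 1:]"
  have B: "pCons a A \<circ>\<^sub>p [:-1, 1:] = [:a:] + (pCons 0 ?B - ?B)"
    by (simp add: pcompose_pCons)
  have deg: "degree A \<le> m" using pCons.prems by (cases "A = 0") auto
  have deg': "coeff ?B k = 0" if "k > m" for k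
    using that deg by (intro coeff_eq_0) (simp add: degree_pcompose)
  show ?case
  proof (cases m)
    case 0
    then obtain c where "A = [:c:]" using deg by (metis degree_eq_zeroE le_zero_eq)
    then show ?thesis using 0 by (simp add: pcompose_pCons)
  next
    case (Suc k)
    with pCons.IH[of k] deg have "coeff ?B (Suc k) = coeff A (Suc k)"
      "coeff ?B k = coeff A k - of_nat (Suc k) * coeff A (Suc k)" by auto
    then show ?thesis using deg'[of "Suc m"] unfolding B Suc by (simp add: algebra_simps)
  qed
qed simp

text \<open>With d the degree of \<open>A\<close>, compare the coefficients of t^d on both sides:
  replacing t by t - 1 lowers the second coefficient by d times the leading one, and
  \<open>r - r'\<close> has to compensate for this.\<close>

lemma degree_of_shift_equation:
  fixes A :: "complex poly"
  assumes "A \<noteq> 0" "\<And>t. (t + r) * poly A (t - 1) = poly A t * (t + r')"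
  shows "r - r' = of_nat (degree A)"
proof -
  let ?B = "A \<circ>\<^sub>p [:-1, 1:]"
  have "poly ([:r, 1:] * ?B) t = poly ([:r', 1:] * A) t" for t
    using assms(2)[of t] by (simp add: poly_pcompose algebra_simps)
  then have eq: "[:r, 1:] * ?B = [:r', 1:] * A" using poly_eq_poly_eq_iff by blast
  show ?thesis
  proof (cases "degree A")
    case 0
    then obtain c where "A = [:c:]" by (metis degree_eq_zeroE)
    then show ?thesis using assms(1) assms(2)[of 0] 0 by simp
  next
    case (Suc m)
    have "coeff ([:r, 1:] * ?B) (Suc m) = coeff ([:r', 1:] * A) (Suc m)" using eq by simp
    then have "(r - of_nat (Suc m)) * coeff A (Suc m) = r' * coeff A (Suc m)"
      using coeff_pcompose_shift[of A m] Suc by (simp add: algebra_simps)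
    moreover have "coeff A (Suc m) \<noteq> 0" using Suc assms(1) by (metis leading_coeff_0_iff)
    ultimately have "r - of_nat (Suc m) = r'" using mult_right_cancel by blast
    then show ?thesis using Suc by (simp add: algebra_simps)
  qed
qed

text \<open>Wherever \<open>f x\<close> is nonzero, the difference is the degree of \<open>f\<close>
  in the variable \<open>i\<close> at that point, hence one of 0, ..., N. So \<open>f\<close> times
  the product of the differences minus these numbers vanishes identically, and in a domain a single
  factor must vanish identically. This makes \<open>m\<close> independent of
  \<open>x\<close>.\<close>

lemma difference_is_nat:
  assumes f: "polyfun f" "f x0 \<noteq> 0" and r: "polyfun r" "\<And>x t. r (x(i := t)) = r x"
    and "i \<noteq> j"
    and eq: "\<And>x. (x i + r x) * f (x(i := x i - 1)) = f x * (x i + r (x(j := x j - 1)))"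
  shows "\<exists>m::nat. \<forall>x. r x - r (x(j := x j - 1)) = of_nat m"
proof -
  obtain A N where A: "\<And>x t. poly (A x) t = f (x(i := t))" "\<And>x. degree (A x) \<le> N"
    using polyfun_univariate[OF f(1), of i] by metis
  let ?d = "\<lambda>x. r x - r (x(j := x j - 1))"
  have pf: "polyfun ?d" using r by auto
  have "(\<Prod>m\<in>{..N}. ?d x - of_nat m) * f x = 0" for x
  proof (cases "f x = 0")
    case False
    then have "poly (A x) (x i) \<noteq> 0" by (simp add: A)
    then have "A x \<noteq> 0" by auto
    moreover have "(t + r x) * poly (A x) (t - 1) = poly (A x) t * (t + r (x(j := x j - 1)))" for t
    proof -
      have "r (x(i := t, j := x j - 1)) = r (x(j := x j - 1))"
        using \<open>i \<noteq> j\<close> r(2)[of "x(j := x j - 1)" t] by (simp add: fun_upd_twist)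
      then show ?thesis using eq[of "x(i := t)"] \<open>i \<noteq> j\<close> by (simp add: A r(2))
    qed
    ultimately have "?d x = of_nat (degree (A x))" by (rule degree_of_shift_equation)
    then have "(\<Prod>m\<in>{..N}. ?d x - of_nat m) = 0"
      using A(2)[of x] by (intro prod_zero) auto
    then show ?thesis by simp
  qed simp
  then have "(\<forall>x. (\<Prod>m\<in>{..N}. ?d x - of_nat m) = 0) \<or> (\<forall>x. f x = 0)"
    by (intro polyfun_mult_eq_0 f polyfun_prod polyfun_diff pf polyfun_const) auto
  then have "\<forall>x. (\<Prod>m\<in>{..N}. ?d x - of_nat m) = 0" using f(2) by blast
  then have "\<exists>m\<in>{..N}. \<forall>x. ?d x - of_nat m = 0"
    using pf by (intro polyfun_prod_eq_0) auto
  then show ?thesis by auto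
qed

section \<open>The relations between the \<open>up P i\<close> and \<open>dn P i\<close>, and the
  trichotomy\<close>

context weight_system
begin

lemma polyfun_up [intro, simp]: "polyfun (up P i)" and polyfun_dn [intro, simp]: "polyfun (dn P i)"
  by (auto simp: up_def dn_def)

lemma up_up: "up P i x * up P j (x(i := x i - 1)) = up P j x * up P i (x(j := x j - 1))"
  using commutator[of "Some i" None "Some j" None x] by (simp add: up_def shift_simps)

lemma up_dn: "up P i x * dn P i (x(i := x i - 1)) - dn P i x * up P i (x(i := x i + 1)) = x i + total x"
  using commutator[of "Some i" None None "Some i" x] by (simp add: up_def dn_def shift_simps coord_def)

lemma up_dn_diff:
  "i \<noteq> j \<Longrightarrow> up P i x * dn P j (x(i := x i - 1)) - dn P j x * up P i (x(j := x j + 1))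
     = eval_mpoly (P (Some i) (Some j)) x"
  using commutator[of "Some i" None None "Some j" x] by (simp add: up_def dn_def shift_simps)

lemma mid_up:
  "i \<noteq> j \<Longrightarrow> i \<noteq> k \<Longrightarrow> j \<noteq> k \<Longrightarrow> eval_mpoly (P (Some i) (Some j)) x * up P k (x(i := x i - 1, j := x j + 1))
     = up P k x * eval_mpoly (P (Some i) (Some j)) (x(k := x k - 1))"
  using commutator[of "Some i" "Some j" "Some k" None x] by (simp add: up_def shift_simps)

lemma mid_up_same:
  "i \<noteq> j \<Longrightarrow> eval_mpoly (P (Some i) (Some j)) x * up P j (x(i := x i - 1, j := x j + 1))
     - up P j x * eval_mpoly (P (Some i) (Some j)) (x(j := x j - 1)) = up P i x"
  using commutator[of "Some i" "Some j" "Some j" None x] by (simp add: up_def shift_simps)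

lemma mid_dn:
  "i \<noteq> j \<Longrightarrow> i \<noteq> k \<Longrightarrow> eval_mpoly (P (Some i) (Some j)) x * dn P k (x(i := x i - 1, j := x j + 1))
     = dn P k x * eval_mpoly (P (Some i) (Some j)) (x(k := x k + 1))"
  using commutator[of "Some i" "Some j" None "Some k" x] by (simp add: dn_def shift_simps)

text \<open>By \<open>up_dn\<close>, the product changes under a unit shift of \<open>x i\<close>
  exactly as \<open>- x i * (total x + 1)\<close> does. The difference \<open>T\<close> of the two
  is therefore free of \<open>x i\<close>, and the product is quadratic in \<open>x i\<close> with
  leading coefficient -1.\<close>

lemma product_eq:
  obtains T where "polyfun T" "\<And>x t. T (x(i := t)) = T x"
    "\<And>x. dn P i x * up P i (x(i := x i + 1)) = T x - x i * (total x + 1)"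
proof
  let ?T = "\<lambda>x. dn P i x * up P i (x(i := x i + 1)) + x i * (total x + 1)"
  show pf: "polyfun ?T"
    by (intro polyfun_add polyfun_mult polyfun_dn polyfun_upd[of "up P i"] polyfun_up polyfun_var
        polyfun_total polyfun_const)
  show "?T (x(i := t)) = ?T x" for x t
  proof (rule polyfun_invariant[OF pf])
    show "?T (x(i := x i - 1)) = ?T x" for x
      using up_dn[of i x] by (simp add: total_upd algebra_simps)
  qed
qed simp

lemma up_nonzero: "\<exists>x. up P i x \<noteq> 0"
proof (rule ccontr)
  assume "\<not> ?thesis"
  then have 0: "up P i x = 0" for x by auto
  obtain T where T: "\<And>x t. T (x(i := t)) = T x"
    "\<And>x. dn P i x * up P i (x(i := x i + 1)) = T x - x i * (total x + 1)"
    by (rule product_eq[of i]) metis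
  \<comment> \<open>If \<open>up P i\<close> were zero, \<open>x i * (total x + 1)\<close> would
    equal \<open>T x\<close> and be free of \<open>x i\<close>, yet it takes different values at the
    origin and at the unit vector of \<open>i\<close>.\<close>
  let ?z = "\<lambda>_. 0 :: complex"
  have "T ?z = 0" "T (?z(i := 1)) = 2"
    using T(2)[of ?z] T(2)[of "?z(i := 1)"] by (simp_all add: 0 total_upd) (simp_all add: total_def)
  then show False by (simp add: T(1))
qed

text \<open>Over each base point the product of the two univariate polynomials has degree 2 and
  leading coefficient -1. Once the two degrees are known not to vary with the point, they are (0,
  2), (2, 0) or (1, 1), and these are the three cases.\<close>

lemma trichotomy: "dn_const P i \<or> up_const P i \<or> (\<exists>a r s. linear_at P i a r s)"
proof -
  obtain T where T: "polyfun T" "\<And>x t. T (x(i := t)) = T x"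
    "\<And>x. dn P i x * up P i (x(i := x i + 1)) = T x - x i * (total x + 1)"
    by (rule product_eq[of i]) metis
  obtain A N where A: "\<And>x t. poly (A x) t = up P i (x(i := t))" "\<And>k. polyfun (\<lambda>x. coeff (A x) k)"
    using polyfun_univariate[OF polyfun_up[of i], of i] by metis
  obtain B N' where B: "\<And>x t. poly (B x) t = dn P i (x(i := t))" "\<And>k. polyfun (\<lambda>x. coeff (B x) k)"
    using polyfun_univariate[OF polyfun_dn[of i], of i] by metis
  have AB: "B x * (A x \<circ>\<^sub>p [:1, 1:]) = [:T x, - (total x - x i + 1), -1:]" for x
  proof -
    have "poly (B x * (A x \<circ>\<^sub>p [:1, 1:])) t = poly [:T x, - (total x - x i + 1), -1:] t" for t
      using T(3)[of "x(i := t)"]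
      by (simp add: A B T(2) poly_pcompose total_upd algebra_simps)
    then show ?thesis using poly_eq_poly_eq_iff by blast
  qed
  have nz: "B x \<noteq> 0" "A x \<noteq> 0" for x using AB[of x] by auto
  have deg: "degree (B x) + degree (A x) = 2" for x
  proof -
    have "A x \<circ>\<^sub>p [:1, 1:] \<noteq> 0" using AB[of x] by auto
    then have "degree (B x) + degree (A x \<circ>\<^sub>p [:1, 1:]) = 2"
      using nz[of x] degree_mult_eq[of "B x" "A x \<circ>\<^sub>p [:1, 1:]"] AB[of x] by simp
    then show ?thesis by (simp add: degree_pcompose)
  qed
  have lead: "lead_coeff (B x) * lead_coeff (A x) = -1" for x
  proof -
    have "lead_coeff (B x) * lead_coeff (A x \<circ>\<^sub>p [:1, 1:]) = -1"
      unfolding lead_coeff_mult[symmetric] AB by simp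
    then show ?thesis by (simp add: lead_coeff_comp)
  qed
  have up: "up P i x = poly (A x) (x i)" and dn: "dn P i x = poly (B x) (x i)" for x
    by (simp_all add: A B)
  \<comment> \<open>The leading coefficient of \<open>A\<close> at \<open>x\<close> and that of
    \<open>B\<close> at \<open>y\<close> extend to polynomial functions that are not identically
    zero, so some \<open>z\<close> is a zero of neither. As the degrees sum to 2 everywhere, this
    forces each of them to be constant.\<close>
  have generic: "\<exists>z. degree (A z) \<ge> degree (A x) \<and> degree (B z) \<ge> degree (B y)" for x y
  proof -
    have "coeff (A x) (degree (A x)) \<noteq> 0" "coeff (B y) (degree (B y)) \<noteq> 0" using nz by auto
    then obtain z where "coeff (A z) (degree (A x)) * coeff (B z) (degree (B y)) \<noteq> 0"
      using polyfun_mult_eq_0[OF A(2)[of "degree (A x)"] B(2)[of "degree (B y)"]] by blast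
    then show ?thesis by (intro exI[of _ z]) (auto intro: le_degree)
  qed
  obtain d e where degA: "\<And>x. degree (A x) = d" and degB: "\<And>x. degree (B x) = e"
  proof -
    have "degree (A x) \<le> degree (A y)" "degree (B x) \<le> degree (B y)" for x y
      using generic[of x y] generic[of y x] deg by (metis add_le_cancel_left add_le_cancel_right le_trans add_mono)+
    then show ?thesis using that by (metis antisym)
  qed
  have de: "e + d = 2" using deg[of undefined] by (simp add: degA degB)
  \<comment> \<open>With constant degrees the leading coefficients vanish nowhere, so they are units
    and hence constants.\<close>
  have A_const: "coeff (A x) d = coeff (A y) d" for x y
    using lead by (intro polyfun_nonzero_const[OF A(2)]) (metis degA leading_coeff_0_iff nz(2))
  have B_const: "coeff (B x) e = coeff (B y) e" for x y
    using lead by (intro polyfun_nonzero_const[OF B(2)]) (metis degB leading_coeff_0_iff nz(1))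
  consider "e = 0" | "d = 0" | "d = 1" "e = 1" using de by linarith
  then show ?thesis
  proof cases
    case 1
    have "dn P i x = coeff (B undefined) 0" for x
      using degB[of x] 1 B_const[of undefined x] unfolding dn 
      by (metis degree_eq_zeroE poly_const_conv coeff_pCons_0)
    moreover have "coeff (B undefined) 0 \<noteq> 0" using nz 1 degB by (metis leading_coeff_0_iff)
    ultimately show ?thesis by (auto simp: dn_const_def)
  next
    case 2
    have "up P i x = coeff (A undefined) 0" for x
      using degA[of x] 2 A_const[of undefined x] unfolding up
      by (metis degree_eq_zeroE poly_const_conv coeff_pCons_0)
    moreover have "coeff (A undefined) 0 \<noteq> 0" using nz 2 degA by (metis leading_coeff_0_iff)
    ultimately show ?thesis by (auto simp: up_const_def)
  next
    case 3
    define a where "a = coeff (A undefined) 1"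
    define r where "r = (\<lambda>x. coeff (A x) 0 * (1 / a))"
    define s where "s = (\<lambda>x. coeff (B x) 0 * (- a))"
    have "coeff (B undefined) e * coeff (A undefined) d = -1"
      using lead[of undefined] by (simp only: degA degB)
    then have a: "coeff (A x) 1 = a" "a \<noteq> 0" for x
      using A_const[of x undefined] 3 by (auto simp: a_def)
    have b: "coeff (B x) 1 = - 1 / a" for x
      using lead[of x] a(1)[of x] a(2) degA[of x] degB[of x] 3 by (simp add: field_simps)
    have Ax: "A x = [:a * r x, a:]" for x
      using degA[of x] a(1)[of x] a(2) 3 by (intro poly_eqI) (auto simp: r_def coeff_pCons coeff_eq_0 split: nat.split)
    have Bx: "B x = [:- s x / a, - 1 / a:]" for x
      using degB[of x] b[of x] a 3 by (intro poly_eqI) (auto simp: s_def coeff_pCons coeff_eq_0 split: nat.split)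
    have "r x + s x = total x - x i" for x
    proof -
      \<comment> \<open>The constant terms satisfy one relation, read off from the linear
        coefficient of the product.\<close>
      have "coeff (B x * (A x \<circ>\<^sub>p [:1, 1:])) 1 = - (total x - x i + 1)" using AB by simp
      then have "- (s x + 1 + r x) = - (total x - x i + 1)"
        using a(2) unfolding Ax Bx by (simp add: pcompose_pCons add_divide_distrib algebra_simps)
      then show ?thesis by algebra
    qed
    moreover have "polyfun r" "polyfun s" unfolding r_def s_def
      by (intro polyfun_mult A B polyfun_const)+
    moreover have "r (x(i := t)) = r x" for x t
    proof -
      have "poly (A (x(i := t))) u = poly (A x) u" for u by (simp add: A)
      then have "A (x(i := t)) = A x" using poly_eq_poly_eq_iff by blast
      then show ?thesis by (simp add: r_def)
    qed
    moreover have "s (x(i := t)) = s x" for x t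
    proof -
      have "poly (B (x(i := t))) u = poly (B x) u" for u by (simp add: B)
      then have "B (x(i := t)) = B x" using poly_eq_poly_eq_iff by blast
      then show ?thesis by (simp add: s_def)
    qed
    ultimately have "linear_at P i a r s"
      unfolding linear_at_def up dn Ax Bx using a(2) by (simp add: field_simps)
    then show ?thesis by blast
  qed
qed

text \<open>Cancelling \<open>a\<close> in \<open>up_up\<close> leaves the equation of
  \<open>difference_is_nat\<close> with \<open>f = up P j\<close>; the natural number is the degree
  of \<open>up P j\<close> in the variable \<open>i\<close>.\<close>

lemma r_difference:
  assumes "linear_at P i a r s" "i \<noteq> j"
  shows "\<exists>m::nat. \<forall>x. r x - r (x(j := x j - 1)) = of_nat m"
proof -
  obtain x0 where "up P j x0 \<noteq> 0" using up_nonzero by blast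
  moreover have "(x i + r x) * up P j (x(i := x i - 1)) = up P j x * (x i + r (x(j := x j - 1)))" for x
    using up_up[of i x j] assms by (simp add: linear_at_def)
  ultimately show ?thesis
    using assms by (intro difference_is_nat[of "up P j" x0 r i j]) (auto simp: linear_at_def)
qed

end

text \<open>The shape of the family of \<open>F_a(M_b^S)\<close>. Only the entries with an index
  \<open>None\<close> are recorded, since \<open>up_dn_diff\<close> recovers the others.\<close>

definition standard ::
    "('n::finite option \<Rightarrow> 'n option \<Rightarrow> 'n mpoly) \<Rightarrow> ('n \<Rightarrow> complex) \<Rightarrow> 'n set \<Rightarrow> complex \<Rightarrow> bool" where
  "standard P a S b \<longleftrightarrow> (\<forall>i. a i \<noteq> 0) \<and>
     (\<forall>i x. up P i x = a i * ((total x + b) * (if i \<in> S then 1 else x i - b - 1))) \<and>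
     (\<forall>i x. dn P i x = - (if i \<in> S then x i - b else 1) / a i)"

section \<open>Dependence on the other variables and reduction to the standard form\<close>

context weight_system
begin

lemma up_eq_0_cancel:
  assumes "polyfun g" "polyfun h" "\<And>x. up P i x * g x = up P i x * h x"
  shows "g x = h x"
  using up_nonzero[of i] polyfun_mult_cancel[OF polyfun_up[of i] assms(1,2)] assms(3) by blast

lemma dual_system: "weight_system (dual P)"
  by (rule weight_system_dual) (rule weight_system_axioms)

text \<open>By \<open>r_difference\<close> for \<open>P\<close> and for its dual, the steps of
  \<open>r\<close> and \<open>s\<close> in direction \<open>j\<close> are natural numbers. They sum
  to 1, because \<open>r + s\<close> contains \<open>x j\<close> with coefficient 1. If the step of
  \<open>r\<close> is 0, then \<open>up P i\<close> does not change with \<open>x j\<close> and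
  cancels from \<open>up_up\<close>, which frees \<open>up P j\<close> of
  \<open>x i\<close>.\<close>

lemma linear_at_dichotomy:
  assumes lin: "linear_at P i a r s" and "i \<noteq> j"
  shows "((\<forall>x. r x - r (x(j := x j - 1)) = 1) \<and> (\<forall>x. s (x(j := x j - 1)) = s x)) \<or>
    ((\<forall>x. r (x(j := x j - 1)) = r x) \<and> (\<forall>x. s x - s (x(j := x j - 1)) = 1) \<and> inv_in (up P j) i)"
proof -
  interpret D: weight_system "dual P" by (rule dual_system)
  obtain m :: nat where m: "\<And>x. r x - r (x(j := x j - 1)) = of_nat m"
    using r_difference[OF lin \<open>i \<noteq> j\<close>] by blast
  obtain n :: nat where n0: "\<And>x. - s (\<lambda>k. - x k) - - s (\<lambda>k. - (x(j := x j - 1)) k) = of_nat n"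
    using D.r_difference[OF linear_at_dual[OF lin] \<open>i \<noteq> j\<close>] by blast
  have n: "s x - s (x(j := x j - 1)) = of_nat n" for x
  proof -
    let ?y = "\<lambda>k. - (x(j := x j - 1)) k"
    have y: "(\<lambda>k. - ?y k) = x(j := x j - 1)" "(\<lambda>k. - (?y(j := ?y j - 1)) k) = x" by auto
    have "- s (x(j := x j - 1)) - - s x = of_nat n" using n0[of ?y] unfolding y .
    then show ?thesis by simp
  qed
  have "r x + s x = total x - x i" for x using lin by (simp add: linear_at_def)
  from this[of "\<lambda>_. 0"] this[of "(\<lambda>_. 0)(j := 0 - 1)"]
  have "r (\<lambda>_. 0) + s (\<lambda>_. 0) = total (\<lambda>_ :: 'n. 0)"
    "r ((\<lambda>_. 0)(j := 0 - 1)) + s ((\<lambda>_. 0)(j := 0 - 1)) = total (\<lambda>_ :: 'n. 0) - 1"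
    using \<open>i \<noteq> j\<close> by (simp_all add: total_upd)
  moreover have "r (\<lambda>_. 0) - r ((\<lambda>_. 0)(j := 0 - 1)) + (s (\<lambda>_. 0) - s ((\<lambda>_. 0)(j := 0 - 1)))
      = (r (\<lambda>_. 0) + s (\<lambda>_. 0)) - (r ((\<lambda>_. 0)(j := 0 - 1)) + s ((\<lambda>_. 0)(j := 0 - 1)))"
    by (simp only: add_diff_add)
  ultimately have "of_nat m + of_nat n = (1 :: complex)"
    using m[of "\<lambda>_. 0"] n[of "\<lambda>_. 0"] by simp
  then have mn: "m + n = 1" using of_nat_eq_iff[of "m + n" 1, where ?'a = complex] by simp
  show ?thesis
  proof (cases "m = 0")
    case False
    then have "m = 1" "n = 0" using mn by auto
    then show ?thesis using m n by simp
  next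
    case True
    then have "n = 1" using mn by auto
    have r: "r (x(j := x j - 1)) = r x" for x using m[of x] True by simp
    have "up P j (x(i := x i - 1)) = up P j x" for x
    proof (rule up_eq_0_cancel[where i = i and g = "\<lambda>x. up P j (x(i := x i - 1))" and h = "up P j"])
      show "polyfun (\<lambda>x. up P j (x(i := x i - 1)))" by (intro polyfun_upd_diff polyfun_up)
      show "up P i x * up P j (x(i := x i - 1)) = up P i x * up P j x" for x
        using up_up[of i x j] lin r[of x] \<open>i \<noteq> j\<close> by (simp add: linear_at_def)
    qed simp
    then show ?thesis using n \<open>n = 1\<close> r by (auto simp: inv_in_def)
  qed
qed

lemma linear_at_not_inv:
  assumes lin: "linear_at P i a r s" and "i \<noteq> j" and "\<not> inv_in (up P i) j"
  shows "r x - r (x(j := x j - 1)) = 1" "s (x(j := x j - 1)) = s x"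
proof -
  have "\<not> (\<forall>x. r (x(j := x j - 1)) = r x)"
    using lin assms(2,3) by (auto simp: inv_in_def linear_at_def)
  then show "r x - r (x(j := x j - 1)) = 1" "s (x(j := x j - 1)) = s x"
    using linear_at_dichotomy[OF lin \<open>i \<noteq> j\<close>] by blast+
qed

text \<open>If the variable \<open>j\<close> is missing from \<open>r\<close> it sits in
  \<open>s\<close>, hence in \<open>dn P i\<close>; the dichotomy also makes the relation symmetric
  in \<open>i\<close> and \<open>j\<close>.\<close>

lemma linear_at_inv:
  assumes lin: "linear_at P i a r s" and "i \<noteq> j" and "inv_in (up P i) j"
  shows "s x - s (x(j := x j - 1)) = 1" "inv_in (up P j) i" "\<not> inv_in (dn P i) j"
proof -
  have "r (x(j := x j - 1)) = r x" for x
    using lin assms(2,3) by (simp add: inv_in_def linear_at_def)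
  then have *: "(\<forall>x. s x - s (x(j := x j - 1)) = 1) \<and> inv_in (up P j) i"
    using linear_at_dichotomy[OF lin \<open>i \<noteq> j\<close>] by force
  then show "s x - s (x(j := x j - 1)) = 1" "inv_in (up P j) i" by blast+
  show "\<not> inv_in (dn P i) j"
  proof
    assume "inv_in (dn P i) j"
    then have "s (x(j := x j - 1)) = s x" for x
      using lin \<open>i \<noteq> j\<close> by (simp add: inv_in_def linear_at_def)
    then show False using * by simp
  qed
qed

lemma inv_in_upd: "polyfun f \<Longrightarrow> inv_in f k \<Longrightarrow> f (x(k := t)) = f x"
  using polyfun_invariant[of f k x t] by (simp add: inv_in_def)

lemma inv_in_all:
  assumes pf: "polyfun f" and inv: "\<And>j. inv_in f j"
  shows "f x = f (\<lambda>_. 0)"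
proof -
  have "f (\<lambda>k. if k \<in> K then x k else 0) = f (\<lambda>_. 0)" if "finite K" for K
    using that
  proof (induction K rule: finite_induct)
    case (insert k K)
    have "(\<lambda>l. if l \<in> insert k K then x l else 0) = (\<lambda>l. if l \<in> K then x l else 0)(k := x k)"
      by auto
    then show ?case using inv_in_upd[OF pf inv] insert.IH by simp
  qed simp
  from this[of UNIV] show ?thesis by simp
qed

text \<open>Under the hypotheses \<open>P (Some i) (Some k)\<close> is just
  \<open>up P i / a'\<close>. The corresponding matrix unit and that of \<open>up P i\<close> both
  commute with that of \<open>up P j\<close>, and they differ in their shift only in the variable
  \<open>k\<close>. Comparing the two relations and cancelling \<open>up P i\<close> removes
  \<open>k\<close> from \<open>up P j\<close>.\<close>

lemma inv_in_propagates:
  assumes i: "linear_at P i a r s" and k: "linear_at P k a' r' s'"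
    and ne: "i \<noteq> k" "j \<noteq> i" "j \<noteq> k" and inv: "inv_in (up P i) k"
  shows "inv_in (up P j) k"
proof -
  have inv': "inv_in (up P k) i" using linear_at_inv(2)[OF i ne(1) inv] .
  have a': "a' \<noteq> 0" using k by (simp add: linear_at_def)
  have mid: "eval_mpoly (P (Some i) (Some k)) x = up P i x / a'" for x
  proof -
    have "dn P k (x(i := x i - 1)) = dn P k x + 1 / a'"
      using linear_at_inv(1)[OF k ne(1)[symmetric] inv', of x] k ne
      by (simp add: linear_at_def field_simps)
    moreover have "up P i (x(k := x k + 1)) = up P i x"
      by (rule inv_in_upd[OF polyfun_up inv])
    ultimately show ?thesis
      using up_dn_diff[OF ne(1), of x] by (simp add: distrib_left mult.commute)
  qed
  have *: "up P j (x(i := x i - 1, k := x k + 1)) = up P j (x(i := x i - 1))" for x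
  proof (rule up_eq_0_cancel[where i = i and g = "\<lambda>x. up P j (x(i := x i - 1, k := x k + 1))"
        and h = "\<lambda>x. up P j (x(i := x i - 1))"])
    show "polyfun (\<lambda>x. up P j (x(i := x i - 1)))" by (intro polyfun_upd_diff polyfun_up)
    have "polyfun (\<lambda>x. up P j (x(i := x i + - 1, k := (x(i := x i + - 1)) k + 1)))"
      by (rule polyfun_upd[where f = "\<lambda>x. up P j (x(k := x k + 1))"], rule polyfun_upd[OF polyfun_up])
    then show "polyfun (\<lambda>x. up P j (x(i := x i - 1, k := x k + 1)))" using ne by simp
    fix x
    have "up P i x * up P j (x(i := x i - 1, k := x k + 1)) = up P j x * up P i (x(j := x j - 1))"
      using mid_up[of i k j x] ne a' by (simp add: mid)
    then show "up P i x * up P j (x(i := x i - 1, k := x k + 1)) = up P i x * up P j (x(i := x i - 1))"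
      using up_up[of i x j] by simp
  qed
  show ?thesis unfolding inv_in_def
  proof
    fix y :: "'n \<Rightarrow> complex"
    have "(y(i := y i + 1, k := y k - 1))(i := y i, k := y k) = y"
      "(y(i := y i + 1, k := y k - 1))(i := y i) = y(k := y k - 1)" using ne by auto
    then show "up P j (y(k := y k - 1)) = up P j y"
      using *[of "y(i := y i + 1, k := y k - 1)"] ne by simp
  qed
qed

section \<open>Indices with constant \<open>dn P i\<close>\<close>

lemma dn_const_up:
  assumes "\<And>x. dn P i x = c" "c \<noteq> 0"
  obtains T where "polyfun T" "\<And>x t. T (x(i := t)) = T x"
    "\<And>x. - c * up P i x = (x i - 1) * total x - T x"
proof -
  obtain T where T: "polyfun T" "\<And>x t. T (x(i := t)) = T x"
    "\<And>x. dn P i x * up P i (x(i := x i + 1)) = T x - x i * (total x + 1)"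
    by (rule product_eq[of i]) metis
  have "- c * up P i x = (x i - 1) * total x - T x" for x
    \<comment> \<open>Evaluating the product one step lower undoes the shift inside
      \<open>up P i\<close>; this is the origin of \<open>x i - 1\<close>.\<close>
    using T(3)[of "x(i := x i - 1)"] assms by (simp add: T(2) total_upd algebra_simps)
  with T that show thesis by blast
qed

text \<open>Otherwise the step of \<open>T\<close> in direction \<open>j\<close> would be
  \<open>x i - 1\<close>, although \<open>T\<close> is free of \<open>x i\<close>.\<close>

lemma dn_const_not_inv:
  assumes "dn_const P i" "i \<noteq> j"
  shows "\<not> inv_in (up P i) j"
proof
  assume inv: "inv_in (up P i) j"
  obtain c where c: "\<And>x. dn P i x = c" "c \<noteq> 0" using assms by (auto simp: dn_const_def)
  obtain T where T: "\<And>x t. T (x(i := t)) = T x"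
    "\<And>x. - c * up P i x = (x i - 1) * total x - T x"
    using dn_const_up[OF c] by metis
  have d: "T x - T (x(j := x j - 1)) = x i - 1" for x
  proof -
    have "up P i (x(j := x j - 1)) = up P i x" using inv by (simp add: inv_in_def)
    then have "(x i - 1) * total x - T x = (x i - 1) * (total x - 1) - T (x(j := x j - 1))"
      using T(2)[of x] T(2)[of "x(j := x j - 1)"] \<open>i \<noteq> j\<close> by (simp add: total_upd)
    then show ?thesis by algebra
  qed
  let ?x = "\<lambda>_. 0 :: complex"
  have "T (?x(i := 1)) - T (?x(i := 1, j := -1)) = 0"
    using d[of "?x(i := 1)"] \<open>i \<noteq> j\<close> by simp
  moreover have "T (?x(i := 1, j := -1)) = T (?x(j := -1))"
    using T(1)[of "?x(j := -1)" 1] \<open>i \<noteq> j\<close> by (simp add: fun_upd_twist)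
  ultimately show False using d[of ?x] T(1)[of ?x 1] by simp
qed

text \<open>For \<open>i = j\<close> the commutator of two constants would be zero instead of
  \<open>x i + total x\<close>. For \<open>i \<noteq> j\<close> a constant \<open>up P j\<close>
  would make \<open>up P i\<close> free of \<open>x j\<close>.\<close>

lemma dn_const_up_const_False:
  assumes "dn_const P i" "up_const P j"
  shows False
proof (cases "i = j")
  case True
  obtain c d where c: "\<And>x. dn P i x = c" "\<And>x. up P i x = d"
    using assms True by (auto simp: dn_const_def up_const_def)
  have "total x + x i = 0" for x
    using up_dn[of i x] by (simp add: c add.commute)
  from this[of "(\<lambda>_. 0)(i := 1)"] this[of "\<lambda>_. 0"] show False by (simp add: total_upd)
next
  case False
  obtain d where d: "d \<noteq> 0" "\<And>x. up P j x = d" using assms by (auto simp: up_const_def)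
  have "inv_in (up P i) j"
    using up_up[of i _ j] d by (simp add: inv_in_def)
  then show False using dn_const_not_inv assms(1) False by blast
qed

text \<open>A single missing variable spreads to all pairs by symmetry and propagation. No
  \<open>dn P i\<close> is then constant, so every index is linear, and the variables missing from
  the \<open>up P i\<close> occur in the \<open>dn P i\<close>.\<close>

lemma dependence_alternative:
  assumes "\<And>i. \<not> up_const P i"
  shows "(\<forall>i j. i \<noteq> j \<longrightarrow> \<not> inv_in (up P i) j) \<or>
    ((\<forall>i. \<exists>a r s. linear_at P i a r s) \<and> (\<forall>i j. i \<noteq> j \<longrightarrow> \<not> inv_in (dn P i) j))"
proof (cases "\<forall>i j. i \<noteq> j \<longrightarrow> \<not> inv_in (up P i) j")
  case False
  have tri: "dn_const P i \<or> (\<exists>a r s. linear_at P i a r s)" for i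
    using trichotomy[of i] assms by blast
  have lin: "\<exists>a r s. linear_at P i a r s" if "inv_in (up P i) j" "i \<noteq> j" for i j
    using tri[of i] dn_const_not_inv that by blast
  have sym: "inv_in (up P j) i" if "inv_in (up P i) j" "i \<noteq> j" for i j
    using lin[OF that] linear_at_inv(2) that by blast
  have propagate: "inv_in (up P l) k" if "inv_in (up P i) k" "i \<noteq> k" "l \<noteq> k" for i k l
  proof (cases "l = i")
    case False
    then show ?thesis
      using lin[OF that(1,2)] lin[OF sym[OF that(1,2)]] inv_in_propagates[of i _ _ _ k _ _ _ l] that by blast
  qed (use that in simp)
  obtain i0 k0 where ik: "i0 \<noteq> k0" "inv_in (up P i0) k0" using False by blast
  \<comment> \<open>From the pair (i0, k0) one passes to (j, k0) by propagation, to (k0, j) by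
    symmetry, and to (i, j) by propagation again.\<close>
  have all: "inv_in (up P i) j" if "i \<noteq> j" for i j
  proof (cases "j = k0")
    case True
    then show ?thesis using propagate[OF ik(2,1)] that by blast
  next
    case False
    then have "inv_in (up P j) k0" using propagate[OF ik(2,1)] by blast
    then have "inv_in (up P k0) j" using sym False by blast
    then show ?thesis using propagate False that by blast
  qed
  have "\<exists>a r s. linear_at P i a r s" for i
    using lin[OF all, of i k0] lin[OF all, of i i0] ik(1) by blast
  then show ?thesis using all linear_at_inv(3) by blast
qed blast

text \<open>Every other variable has step 1 in \<open>r\<close>, so \<open>r\<close> minus the sum
  of the other variables contains no variable and is a constant \<open>b\<close>; the sum condition
  then makes \<open>s\<close> equal to \<open>- b\<close>.\<close>

lemma linear_at_form:
  assumes lin: "linear_at P i a r s" and dep: "\<And>j. i \<noteq> j \<Longrightarrow> \<not> inv_in (up P i) j"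
  shows "\<exists>a b. a \<noteq> 0 \<and> (\<forall>x. up P i x = a * (total x + b)) \<and> (\<forall>x. dn P i x = - (x i - b) / a)"
proof -
  define q where "q = (\<lambda>x. r x - (total x - x i))"
  have "polyfun q" using lin by (auto simp: linear_at_def q_def)
  moreover have "inv_in q j" for j
  proof (cases "j = i")
    case True
    then show ?thesis using lin by (simp add: inv_in_def linear_at_def total_upd q_def)
  next
    case False
    then have "r x - r (x(j := x j - 1)) = 1" for x
      using linear_at_not_inv(1)[OF lin _ dep, of j] by blast
    then have "r (x(j := x j - 1)) = r x - 1" for x
      by (metis diff_eq_eq add.commute)
    then show ?thesis using False by (simp add: inv_in_def total_upd q_def)
  qed
  ultimately have "q x = q (\<lambda>_. 0)" for x by (rule inv_in_all[of q])
  then obtain b where b: "\<And>x. q x = b" by blast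
  have r: "r x = total x - x i + b" for x using b[of x] by (simp add: q_def diff_eq_eq add.commute)
  have s: "s x = - b" for x
  proof -
    have "r x + s x = total x - x i" using lin by (simp add: linear_at_def)
    then have "b + s x = 0" unfolding r[of x] by (simp add: add.assoc)
    then show ?thesis by (simp add: add_eq_0_iff)
  qed
  have up: "up P i x = a * (x i + r x)" and dn: "dn P i x = - (x i + s x) / a" for x
    using lin by (auto simp: linear_at_def)
  show ?thesis
  proof (intro exI conjI allI)
    show "a \<noteq> 0" using lin by (simp add: linear_at_def)
    show "up P i x = a * (total x + b)" for x unfolding up r[of x] by simp
    show "dn P i x = - (x i - b) / a" for x unfolding dn s[of x] by simp
  qed
qed

lemma linear_linear:
  assumes "\<And>x. up P i x = a * (total x + b)" "\<And>x. up P j x = a' * (total x + b')" "a \<noteq> 0" "a' \<noteq> 0"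
  shows "b = b'"
proof -
  let ?z = "\<lambda>_. 0 :: complex"
  have z: "total ?z = 0" by (simp add: total_def)
  have "a * b * (a' * (b' - 1)) = a' * b' * (a * (b - 1))"
    using up_up[of i ?z j] by (simp add: assms(1,2) total_upd z)
  then have "a * a' * (b - b') = 0" by algebra
  then show ?thesis using assms(3,4) by simp
qed

text \<open>A single linear index \<open>i\<close> fixes the unknown \<open>T\<close> of every index
  \<open>j\<close> with constant \<open>dn P j\<close>. Since \<open>T\<close> is free of
  \<open>x j\<close>, the relation \<open>up_up\<close> at \<open>x j = 0\<close> and at
  \<open>x j = 1\<close> gives two equations in the same unknowns, \<open>T\<close> at
  \<open>x\<close> and at its shift in \<open>i\<close>, which determine \<open>T x\<close>.\<close>

lemma linear_dn_const:
  assumes up: "\<And>x. up P i x = a * (total x + b)" "a \<noteq> 0" and c: "\<And>x. dn P j x = c" "c \<noteq> 0"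
    and "i \<noteq> j"
  shows "- c * up P j x = (total x + b) * (x j - b - 1)"
proof -
  obtain T where T: "\<And>x t. T (x(j := t)) = T x"
    "\<And>x. - c * up P j x = (x j - 1) * total x - T x"
    using dn_const_up[OF c] by metis
  have eq: "(total y + b) * ((y j - 1) * (total y - 1) - T (y(i := y i - 1)))
      = ((y j - 1) * total y - T y) * (total y - 1 + b)" for y
  proof -
    have "up P i y * (- c * up P j (y(i := y i - 1))) = - c * up P j y * up P i (y(j := y j - 1))"
      using up_up[of i y j] by simp
    then have "a * ((total y + b) * ((y j - 1) * (total y - 1) - T (y(i := y i - 1))))
      = a * (((y j - 1) * total y - T y) * (total y - 1 + b))"
      unfolding T(2) up(1) using \<open>i \<noteq> j\<close> by (simp add: total_upd algebra_simps)
    then show ?thesis using up(2) mult_left_cancel by blast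
  qed
  define K U U' where "K = total x - x j" and "U = T x" and "U' = T (x(i := x i - 1))"
  have T': "T (x(j := t, i := x i - 1)) = U'" for t
    using T(1)[of "x(i := x i - 1)" t] \<open>i \<noteq> j\<close> by (simp add: U'_def fun_upd_twist)
  have "(K + b) * (- (K - 1) - U') = (- K - U) * (K - 1 + b)"
    "(K + 1 + b) * (- U') = - U * (K + b)"
    using eq[of "x(j := 0)"] eq[of "x(j := 1)"] \<open>i \<noteq> j\<close>
    by (simp_all add: T T' total_upd flip: K_def U_def) 
  then have "U = b * (K + b + 1)" by algebra
  then show ?thesis unfolding T(2) unfolding U_def K_def by algebra
qed

text \<open>As all the \<open>dn P k\<close> are constant, \<open>mid_dn\<close> shows that
  \<open>P (Some i) (Some j)\<close> contains no variable other than \<open>i\<close>. Up to a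
  factor and an affine term in \<open>x i\<close> it is the step of \<open>T i\<close> in direction
  \<open>j\<close>, so this step is a constant \<open>d i j\<close>. Inserting this into
  \<open>mid_up_same\<close> factors \<open>up P i\<close>.\<close>

lemma all_dn_const_form:
  assumes c: "\<And>i x. dn P i x = c i" "\<And>i. c i \<noteq> 0"
  shows "\<exists>d. \<forall>i j. i \<noteq> j \<longrightarrow> d i j = d j i \<and>
    (\<forall>x. - c i * up P i x = (x i - 1 - d i j) * (total x + d i j))"
proof -
  have "\<exists>T. polyfun T \<and> (\<forall>x t. T (x(i := t)) = T x) \<and> (\<forall>x. - c i * up P i x = (x i - 1) * total x - T x)" for i
    using dn_const_up[OF c] by metis
  then obtain T where T: "\<And>i. polyfun (T i)" "\<And>i x t. T i (x(i := t)) = T i x"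
    "\<And>i x. - c i * up P i x = (x i - 1) * total x - T i x" by metis
  let ?e = "\<lambda>i j. eval_mpoly (P (Some i) (Some j))"
  have e: "- c i * ?e i j x = c j * (- (x i - 1) + (T i (x(j := x j + 1)) - T i x))" if "i \<noteq> j" for i j x
  proof -
    have "- c i * ?e i j x = c j * (- c i * up P i x - (- c i * up P i (x(j := x j + 1))))"
      unfolding up_dn_diff[OF that, of x, symmetric] c(1) by (simp add: algebra_simps)
    then show ?thesis unfolding T(3) using that by (simp add: total_upd algebra_simps)
  qed
  have e_inv: "?e i j (x(k := x k + 1)) = ?e i j x" if "i \<noteq> j" "i \<noteq> k" for i j k x
    using mid_dn[OF that, of x] c by simp
  define D where "D = (\<lambda>i j x. T i (x(j := x j + 1)) - T i x)"
  define d where "d = (\<lambda>i j. D i j (\<lambda>_. 0))"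
  have "D i j x = d i j" if "i \<noteq> j" for i j x
    unfolding d_def
  proof (rule inv_in_all[of "D i j"])
    show "polyfun (D i j)" unfolding D_def by (intro polyfun_diff polyfun_upd T)
    have eD: "- c i * ?e i j x = c j * (- (x i - 1) + D i j x)" for x
      using e[OF that] unfolding D_def .
    show "inv_in (D i j) k" for k
    proof (cases "k = i")
      case True
      have "T i (x(i := t, j := x j + 1)) = T i (x(j := x j + 1))" for x t
        using T(2)[of i "x(j := x j + 1)" t] that by (simp add: fun_upd_twist)
      then show ?thesis using True that by (simp add: inv_in_def D_def T(2))
    next
      case False
      have "D i j (x(k := x k - 1)) = D i j x" for x
      proof -
        have "?e i j (x(k := x k - 1)) = ?e i j x"
          using e_inv[OF that, of k "x(k := x k - 1)"] False by simp
        moreover have "- c i * ?e i j (x(k := x k - 1)) = c j * (- (x i - 1) + D i j (x(k := x k - 1)))"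
          using eD[of "x(k := x k - 1)"] False by simp
        ultimately have "c j * (- (x i - 1) + D i j (x(k := x k - 1))) = c j * (- (x i - 1) + D i j x)"
          using eD[of x] by argo
        then show ?thesis using c(2)[of j] by simp
      qed
      then show ?thesis by (simp add: inv_in_def)
    qed
  qed
  then have d: "T i (x(j := x j + 1)) - T i x = d i j" if "i \<noteq> j" for i j x
    using that unfolding D_def by blast
  have form: "- c i * up P i x = (x i - 1 - d i j) * (total x + d j i)" if "i \<noteq> j" for i j x
  proof -
    let ?y = "x(i := x i - 1, j := x j + 1)"
    have "T j x - T j (x(i := x i - 1)) = d j i"
      using d[of j i "x(i := x i - 1)"] that by simp
    from this[symmetric] have "T j ?y = T j x - d j i" by (simp add: T(2))
    then have y: "- c j * up P j ?y = x j * total x - (T j x - d j i)"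
      unfolding T(3) using that by (simp add: total_upd)
    have "?e i j (x(j := x j - 1)) = ?e i j x"
      using e_inv[OF that that, of "x(j := x j - 1)"] by simp
    \<comment> \<open>As \<open>?e i j\<close> is free of \<open>x j\<close>, both terms of
      \<open>mid_up_same\<close> carry the same factor, leaving a difference of
      \<open>up P j\<close>, which is affine in the \<open>total\<close>.\<close>
    then have m: "?e i j x * (up P j ?y - up P j x) = up P i x"
      using mid_up_same[OF that, of x] by (simp add: algebra_simps)
    have E: "- c i * ?e i j x = c j * (- (x i - 1) + d i j)" using e[OF that] d[OF that] by simp
    have "c j * (- c i * up P i x) = (- c i * ?e i j x) * (c j * up P j ?y - c j * up P j x)"
      unfolding m[symmetric] by algebra
    also have "\<dots> = (c j * (- (x i - 1) + d i j)) * (- (total x + d j i))"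
      unfolding E using y T(3)[of j x] by algebra
    finally have "c j * (- c i * up P i x) = c j * ((x i - 1 - d i j) * (total x + d j i))" by algebra
    then show ?thesis using c(2)[of j] mult_left_cancel by blast
  qed
  have "d i j = d j i" if "i \<noteq> j" for i j
  proof -
    define z where "z = (\<lambda>_::'n. 0 :: complex)"
    have z: "total z = 0" "z i = 0" by (simp_all add: total_def z_def)
    \<comment> \<open>\<open>T i\<close> agrees at the origin and at the unit vector of
      \<open>i\<close>, so the two factored values may be compared.\<close>
    have "- T i z = (- 1 - d i j) * d j i" "- T i z = - d i j * (1 + d j i)"
      using form[OF that, of z] form[OF that, of "z(i := 1)"] unfolding T(3)
      by (simp_all add: total_upd T(2) z)
    then show ?thesis by algebra
  qed
  then have "\<forall>i j. i \<noteq> j \<longrightarrow> d i j = d j i \<and>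
    (\<forall>x. - c i * up P i x = (x i - 1 - d i j) * (total x + d i j))" using form by simp
  then show ?thesis by blast
qed

lemma all_dn_const_standard:
  assumes c: "\<And>i x. dn P i x = c i" "\<And>i. c i \<noteq> 0" and card: "CARD('n) > 1"
  shows "\<exists>b. \<forall>i x. - c i * up P i x = (total x + b) * (x i - b - 1)"
proof -
  obtain d where sym: "\<And>i j. i \<noteq> j \<Longrightarrow> d i j = d j i"
    and d: "\<And>i j x. i \<noteq> j \<Longrightarrow> - c i * up P i x = (x i - 1 - d i j) * (total x + d i j)"
    using all_dn_const_form[OF c] by blast
  have eq: "d i j = d i k" if "i \<noteq> j" "i \<noteq> k" for i j k
  proof -
    have z: "total (\<lambda>_::'n. 0 :: complex) = 0" by (simp add: total_def)
    have "(x i - 1 - d i j) * (total x + d i j) = (x i - 1 - d i k) * (total x + d i k)" for x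
      using d[OF that(1), of x] d[OF that(2), of x] by simp
    \<comment> \<open>The second point alone determines \<open>d i j\<close> only up to sign; the
      first removes the ambiguity.\<close>
    from this[of "(\<lambda>_. 0)(i := 1)"] this[of "(\<lambda>_. 0)(i := 1, j := -1)"]
    have "d i j * (1 + d i j) = d i k * (1 + d i k)" "d i j * d i j = d i k * d i k"
      using that by (simp_all add: total_upd z)
    then show ?thesis by algebra
  qed
  obtain i0 j0 :: 'n where ij: "i0 \<noteq> j0"
    using card card_le_Suc0_iff_eq[of "UNIV :: 'n set"] by auto
  have "- c i * up P i x = (total x + d i0 j0) * (x i - d i0 j0 - 1)" for i x
  proof (cases "i = i0")
    case True
    then show ?thesis using d[OF ij, of x] by (simp add: algebra_simps)
  next
    case False
    then have "d i i0 = d i0 j0" using sym eq[of i0 i j0] ij by metis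
    then show ?thesis using d[OF False, of x] by (simp add: algebra_simps)
  qed
  then show ?thesis by blast
qed

text \<open>The indices outside \<open>S\<close> are those with constant \<open>dn P i\<close>. If
  \<open>S\<close> is nonempty, any of its members fixes the common \<open>b\<close>; otherwise
  \<open>all_dn_const_standard\<close> supplies it.\<close>

lemma standard_if_dependent:
  assumes card: "CARD('n) > 1"
    and tri: "\<And>i. dn_const P i \<or> (\<exists>a r s. linear_at P i a r s)"
    and dep: "\<And>i j. i \<noteq> j \<Longrightarrow> \<not> inv_in (up P i) j"
  shows "\<exists>a S b. standard P a S b"
proof -
  define S where "S = {i. \<not> dn_const P i}"
  have "\<exists>a b. a \<noteq> 0 \<and> (\<forall>x. up P i x = a * (total x + b)) \<and> (\<forall>x. dn P i x = - (x i - b) / a)"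
    if i: "i \<in> S" for i
  proof -
    obtain a r s where "linear_at P i a r s" using tri[of i] i unfolding S_def by blast
    then show ?thesis by (rule linear_at_form) (rule dep)
  qed
  then obtain a b where lin: "\<And>i. i \<in> S \<Longrightarrow> a i \<noteq> 0"
    "\<And>i x. i \<in> S \<Longrightarrow> up P i x = a i * (total x + b i)"
    "\<And>i x. i \<in> S \<Longrightarrow> dn P i x = - (x i - b i) / a i" by metis
  have "\<exists>c. c \<noteq> 0 \<and> (\<forall>x. dn P i x = c)" if "i \<notin> S" for i
    using that unfolding S_def dn_const_def by blast
  then obtain c where c: "\<And>i. i \<notin> S \<Longrightarrow> c i \<noteq> 0" "\<And>i x. i \<notin> S \<Longrightarrow> dn P i x = c i" by metis
  have "\<exists>b'. (\<forall>i\<in>S. b i = b') \<and> (\<forall>i x. i \<notin> S \<longrightarrow> - c i * up P i x = (total x + b') * (x i - b' - 1))"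
  proof (cases "S = {}")
    case True
    then show ?thesis using all_dn_const_standard[of c] c card by simp
  next
    case False
    then obtain i0 where i0: "i0 \<in> S" by blast
    have "b i = b i0" if "i \<in> S" for i
      using linear_linear[OF lin(2)[OF that] lin(2)[OF i0]] lin(1) i0 that by blast
    moreover have "- c i * up P i x = (total x + b i0) * (x i - b i0 - 1)" if "i \<notin> S" for i x
      using linear_dn_const[OF lin(2)[OF i0] lin(1)[OF i0] c(2)[OF that] c(1)[OF that]] i0 that by blast
    ultimately show ?thesis by blast
  qed
  then obtain b' where b': "\<And>i. i \<in> S \<Longrightarrow> b i = b'"
    "\<And>i x. i \<notin> S \<Longrightarrow> - c i * up P i x = (total x + b') * (x i - b' - 1)" by blast
  have "standard P (\<lambda>i. if i \<in> S then a i else - 1 / c i) S b'"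
    unfolding standard_def
  proof (intro conjI allI)
    fix i x
    show "(if i \<in> S then a i else - 1 / c i) \<noteq> 0" using lin c by simp
    show "up P i x = (if i \<in> S then a i else - 1 / c i) *
        ((total x + b') * (if i \<in> S then 1 else x i - b' - 1))"
    proof (cases "i \<in> S")
      case False
      then show ?thesis using b'(2)[OF False, of x, symmetric] c(1)[OF False] by simp
    qed (simp add: lin b')
    show "dn P i x = - (if i \<in> S then x i - b' else 1) / (if i \<in> S then a i else - 1 / c i)"
    proof (cases "i \<in> S")
      case True
      then show ?thesis unfolding lin(3)[OF True] b'(1)[OF True] by simp
    qed (simp add: c)
  qed
  then show ?thesis by blast
qed

lemma standard_or_dual_if_no_up_const:
  assumes card: "CARD('n) > 1" and no: "\<And>i. \<not> up_const P i"
  shows "(\<exists>a S b. standard P a S b) \<or> (\<exists>a S b. standard (dual P) a S b)"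
  using dependence_alternative[OF no]
proof
  assume *: "\<forall>i j. i \<noteq> j \<longrightarrow> \<not> inv_in (up P i) j"
  have "dn_const P i \<or> (\<exists>a r s. linear_at P i a r s)" for i
    using trichotomy[of i] no[of i] by blast
  from standard_if_dependent[OF card this] * show ?thesis by simp
next
  assume *: "(\<forall>i. \<exists>a r s. linear_at P i a r s) \<and> (\<forall>i j. i \<noteq> j \<longrightarrow> \<not> inv_in (dn P i) j)"
  interpret D: weight_system "dual P" by (rule dual_system)
  have "up (dual P) i = (\<lambda>x. - dn P i (\<lambda>k. - x k))" for i by (rule ext) (rule up_dual)
  then have dep: "\<not> inv_in (up (dual P) i) j" if "i \<noteq> j" for i j
    using * that by (simp add: inv_in_negate)
  have "dn_const (dual P) i \<or> (\<exists>a r s. linear_at (dual P) i a r s)" for i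
  proof -
    obtain a r s where "linear_at P i a r s" using * by blast
    from linear_at_dual[OF this] show ?thesis by blast
  qed
  from D.standard_if_dependent[OF card this dep] show ?thesis by simp
qed

text \<open>A constant \<open>up P i\<close> excludes every constant \<open>dn P j\<close>, so
  \<open>P\<close> or its dual has no constant \<open>up\<close>; the previous lemma applies to that
  one.\<close>

lemma standard_or_dual:
  assumes card: "CARD('n) > 1"
  shows "(\<exists>a S b. standard P a S b) \<or> (\<exists>a S b. standard (dual P) a S b)"
proof (cases "\<exists>i. up_const P i")
  case False
  then show ?thesis using standard_or_dual_if_no_up_const[OF card] by blast
next
  case True
  interpret D: weight_system "dual P" by (rule dual_system)
  have "\<not> up_const (dual P) i" for i
  proof
    assume "up_const (dual P) i"
    then obtain c where c: "c \<noteq> 0" "\<And>x. - dn P i (\<lambda>k. - x k) = c" by (auto simp: up_const_def up_dual)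
    have "dn P i x = - c" for x
      using c(2)[of "\<lambda>k. - x k"] equation_minus_iff[of "dn P i x" c] by simp
    then have "dn_const P i" using c(1) unfolding dn_const_def by (intro exI[of _ "- c"]) simp
    then show False using True dn_const_up_const_False by blast
  qed
  then show ?thesis using D.standard_or_dual_if_no_up_const[OF card] by auto
qed

end

section \<open>Modules realised on the polynomial ring\<close>

definition shift_poly :: "'n::finite option \<Rightarrow> 'n option \<Rightarrow> 'n mpoly \<Rightarrow> 'n mpoly" where
  "shift_poly i j = subst (\<lambda>k. var k - (if i = Some k then 1 else 0) + (if j = Some k then 1 else 0))"

lemma eval_shift_poly [simp]: "eval_mpoly (shift_poly i j f) x = eval_mpoly f (shift i j x)"
  unfolding shift_poly_def eval_subst
  by (rule arg_cong[where f = "eval_mpoly f"]) (auto simp: shift_def)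

lemma shift_poly_add: "shift_poly i j (f + g) = shift_poly i j f + shift_poly i j g"
  and shift_poly_mult: "shift_poly i j (f * g) = shift_poly i j f * shift_poly i j g"
  and shift_poly_const [simp]: "shift_poly i j (const c) = const c"
  by (rule mpoly_eqI, simp)+

lemma shift_poly_1 [simp]: "shift_poly i j 1 = 1"
  using shift_poly_const[of i j 1] by simp

text \<open>The formula of \<open>module_M\<close> for an arbitrary family \<open>P\<close>: the
  Cartan part multiplies, and the matrix unit at \<open>i j\<close> multiplies by
  \<open>P i j\<close> after a shift.\<close>

definition system_act ::
    "('n::finite option \<Rightarrow> 'n option \<Rightarrow> 'n mpoly) \<Rightarrow> 'n mat \<Rightarrow> 'n mpoly \<Rightarrow> 'n mpoly" where
  "system_act P x f =
     (\<Sum>k\<in>UNIV. const (x $ Some k $ Some k - x $ None $ None) * (var k * f)) +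
     (\<Sum>i\<in>UNIV. \<Sum>j\<in>UNIV - {i}. const (x $ i $ j) * (P i j * shift_poly i j f))"

lemma system_act_cong:
  assumes "\<And>i j. i \<noteq> j \<Longrightarrow> P i j = Q i j"
  shows "system_act P x f = system_act Q x f"
  unfolding system_act_def using assms by (auto intro!: sum.cong)

lemma system_act_add: "system_act P (x + y) f = system_act P x f + system_act P y f"
proof -
  have *: "const (c + d - (c' + d')) = const (c - c') + const (d - d')" for c d c' d'
    by (simp only: add_diff_add const_add)
  show ?thesis
    by (simp add: system_act_def * const_add distrib_right sum.distrib)
qed

lemma system_act_scale: "system_act P (map_matrix ((*) c) x) f = const c * system_act P x f"
  by (simp add: system_act_def distrib_left sum_distrib_left mult.assoc const_mult
      flip: right_diff_distrib)

lemma system_act_add_right: "system_act P x (f + g) = system_act P x f + system_act P x g"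
  by (simp add: system_act_def shift_poly_add distrib_left sum.distrib)

lemma system_act_scale_right: "system_act P x (const c * f) = const c * system_act P x f"
  by (simp add: system_act_def shift_poly_mult distrib_left sum_distrib_left mult.left_commute)

lemma system_act_matrix_unit:
  assumes "i \<noteq> j"
  shows "system_act P (matrix_unit i j) f = P i j * shift_poly i j f"
proof -
  let ?e = "matrix_unit i j :: 'a mat"
  have "(\<Sum>p\<in>UNIV. \<Sum>q\<in>UNIV - {p}. const (?e $ p $ q) * (P p q * shift_poly p q f))
      = (\<Sum>p\<in>UNIV. \<Sum>q\<in>UNIV - {p}. if p = i then if q = j then P i j * shift_poly i j f else 0 else 0)"
    by (intro sum.cong refl) (auto simp: matrix_unit_def)
  also have "\<dots> = (\<Sum>p\<in>UNIV. if p = i then \<Sum>q\<in>UNIV - {i}. if q = j then P i j * shift_poly i j f else 0 else 0)"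
    by (intro sum.cong refl) auto
  also have "\<dots> = P i j * shift_poly i j f" using assms by (simp add: sum.delta)
  finally have "(\<Sum>p\<in>UNIV. \<Sum>q\<in>UNIV - {p}. const (?e $ p $ q) * (P p q * shift_poly p q f))
      = P i j * shift_poly i j f" .
  moreover have "?e $ k $ k = 0" for k using assms by (auto simp: matrix_unit_def)
  ultimately show ?thesis by (simp add: system_act_def)
qed

lemma system_act_diagonal:
  assumes "\<And>i j. i \<noteq> j \<Longrightarrow> x $ i $ j = 0"
  shows "system_act P x f = (\<Sum>k\<in>UNIV. const (x $ Some k $ Some k - x $ None $ None) * var k) * f"
proof -
  have "(\<Sum>i\<in>UNIV. \<Sum>j\<in>UNIV - {i}. const (x $ i $ j) * (P i j * shift_poly i j f)) = 0"
    using assms by (intro sum.neutral ballI) auto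
  then show ?thesis by (simp add: system_act_def sum_distrib_right mult.assoc)
qed

lemma system_act_cartan_h: "system_act P (cartan_h k) f = var k * f"
proof -
  have "(\<Sum>i\<in>UNIV. const ((cartan_h k $ Some i $ Some i) - cartan_h k $ None $ None) * var i)
      = (\<Sum>i\<in>UNIV. if i = k then var i else 0)"
    by (intro sum.cong) (auto simp: cartan_h_nth)
  then show ?thesis by (simp add: system_act_diagonal cartan_h_nth)
qed

section \<open>Matrix units and linear extension from a basis of \<open>sl\<close>\<close>

lemma matrix_unit_mult:
  "matrix_unit i j ** matrix_unit k l = (if j = k then matrix_unit i l else (0 :: 'n::finite mat))"
proof -
  have "(\<Sum>m\<in>UNIV. (matrix_unit i j :: 'n mat) $ p $ m * (matrix_unit k l :: 'n mat) $ m $ q)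
      = (\<Sum>m\<in>UNIV. if m = j then (if p = i \<and> j = k \<and> q = l then 1 else 0) else 0)" for p q
    by (intro sum.cong) (auto simp: matrix_unit_def)
  then show ?thesis by (auto simp: vec_eq_iff matrix_matrix_mult_def) (auto simp: matrix_unit_def)
qed

lemma bracket_matrix_unit:
  "bracket (matrix_unit i j) (matrix_unit k l) =
     (if j = k then matrix_unit i l else 0) - (if l = i then matrix_unit k j else (0 :: 'n::finite mat))"
  by (simp add: bracket_def matrix_unit_mult)

lemma bracket_in_sl: "bracket x y \<in> sl"
  using trace_mul_sym[of x y] by (simp add: bracket_def sl_def trace_sub)

lemma sl_add: "x \<in> sl \<Longrightarrow> y \<in> sl \<Longrightarrow> x + y \<in> sl"
  by (simp add: sl_def trace_add)

lemma sl_scale: "x \<in> sl \<Longrightarrow> map_matrix ((*) c) x \<in> sl"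
  by (simp add: sl_def trace_def flip: sum_distrib_left)

lemma sl_0: "0 \<in> sl"
  by (simp add: sl_def trace_def)

lemma sl_sum: "(\<And>i. i \<in> A \<Longrightarrow> f i \<in> sl) \<Longrightarrow> sum f A \<in> sl"
  by (induction A rule: infinite_finite_induct) (auto simp: sl_0 sl_add)

lemma sl_linear_extension:
  fixes A B :: "'n::finite mat \<Rightarrow> 'v::ab_group_add"
  assumes add: "\<And>x y. x \<in> sl \<Longrightarrow> y \<in> sl \<Longrightarrow> A (x + y) = A x + A y"
      "\<And>x y. x \<in> sl \<Longrightarrow> y \<in> sl \<Longrightarrow> B (x + y) = B x + B y"
    and scale: "\<And>c x. x \<in> sl \<Longrightarrow> A (map_matrix ((*) c) x) = s c (A x)"
      "\<And>c x. x \<in> sl \<Longrightarrow> B (map_matrix ((*) c) x) = s c (B x)"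
    and basis: "\<And>k. A (cartan_h k) = B (cartan_h k)"
      "\<And>i j. i \<noteq> j \<Longrightarrow> A (matrix_unit i j) = B (matrix_unit i j)"
    and "x \<in> sl"
  shows "A x = B x"
proof -
  have zero: "A 0 = 0" "B 0 = 0" using add[of 0 0] sl_0 by simp_all
  have eq_sum: "A (sum f I) = B (sum f I)" if "\<And>i. i \<in> I \<Longrightarrow> f i \<in> sl \<and> A (f i) = B (f i)" for f :: "'i \<Rightarrow> 'n mat" and I
    using that
  proof (induction I rule: infinite_finite_induct)
    case (insert i I)
    then show ?case using add[of "f i" "sum f I"] sl_sum[of I f] by simp
  qed (simp_all add: zero)
  let ?D = "\<Sum>k\<in>UNIV. map_matrix ((*) (x $ Some k $ Some k - x $ None $ None)) (cartan_h k)"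
  let ?E = "\<Sum>i\<in>UNIV. \<Sum>j\<in>UNIV - {i}. map_matrix ((*) (x $ i $ j)) (matrix_unit i j)"
  have D: "A ?D = B ?D" by (rule eq_sum) (simp add: scale basis cartan_h_in_sl sl_scale)
  have E': "\<And>i. (\<Sum>j\<in>UNIV - {i}. map_matrix ((*) (x $ i $ j)) (matrix_unit i j)) \<in> sl"
    by (rule sl_sum) (auto intro: sl_scale matrix_unit_in_sl)
  have E: "A ?E = B ?E"
  proof (rule eq_sum, intro conjI E')
    fix i :: "'n option"
    show "A (\<Sum>j\<in>UNIV - {i}. map_matrix ((*) (x $ i $ j)) (matrix_unit i j))
      = B (\<Sum>j\<in>UNIV - {i}. map_matrix ((*) (x $ i $ j)) (matrix_unit i j))"
      by (rule eq_sum) (auto simp: scale basis matrix_unit_in_sl sl_scale)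
  qed
  have "?D \<in> sl" by (rule sl_sum) (simp add: cartan_h_in_sl sl_scale)
  moreover have "?E \<in> sl" by (rule sl_sum) (rule E')
  ultimately have "A (?D + ?E) = B (?D + ?E)" using D E add by simp
  then show ?thesis using sl_basis[OF \<open>x \<in> sl\<close>] by simp
qed

text \<open>A choice of free generator, \<open>\<Phi> 1\<close>, turns \<open>V\<close> into the
  polynomial ring with the action \<open>system_act P\<close>. Keeping \<open>V\<close> on its own
  type allows modules with any carrier.\<close>

definition realises ::
    "('n::finite, 'v::ab_group_add) slmod \<Rightarrow> ('n mpoly \<Rightarrow> 'v) \<Rightarrow> ('n option \<Rightarrow> 'n option \<Rightarrow> 'n mpoly) \<Rightarrow> bool" where
  "realises V \<Phi> P \<longleftrightarrow> is_slmod V \<and> bij \<Phi> \<and> (\<forall>p q. \<Phi> (p + q) = \<Phi> p + \<Phi> q) \<and>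
     (\<forall>c p. \<Phi> (const c * p) = smult V c (\<Phi> p)) \<and>
     (\<forall>x\<in>sl. \<forall>p. act V x (\<Phi> p) = \<Phi> (system_act P x p))"

lemma realises_cong:
  assumes "realises V \<Phi> P" "\<And>i j. i \<noteq> j \<Longrightarrow> P i j = Q i j"
  shows "realises V \<Phi> Q"
  using assms(1) system_act_cong[of P Q] assms(2) by (auto simp: realises_def)

lemma realises_additive:
  assumes "realises V \<Phi> P"
  shows "\<Phi> 0 = 0" "\<Phi> (- p) = - \<Phi> p" "\<Phi> (p - q) = \<Phi> p - \<Phi> q"
proof -
  interpret additive \<Phi> using assms by unfold_locales (simp add: realises_def)
  show "\<Phi> 0 = 0" "\<Phi> (- p) = - \<Phi> p" "\<Phi> (p - q) = \<Phi> p - \<Phi> q"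
    by (rule zero minus diff)+
qed

lemma realises_bracket:
  assumes V: "realises V \<Phi> P" and "x \<in> sl" "y \<in> sl"
  shows "system_act P (bracket x y) f = system_act P x (system_act P y f) - system_act P y (system_act P x f)"
proof -
  have "\<Phi> (system_act P (bracket x y) f) = act V (bracket x y) (\<Phi> f)"
    using V by (simp add: realises_def bracket_in_sl)
  also have "\<dots> = act V x (act V y (\<Phi> f)) - act V y (act V x (\<Phi> f))"
    using V assms(2,3) by (simp add: realises_def is_slmod_def)
  also have "\<dots> = \<Phi> (system_act P x (system_act P y f) - system_act P y (system_act P x f))"
    using V assms(2,3) by (simp add: realises_def realises_additive[OF V])
  finally show ?thesis using V by (auto simp: realises_def bij_def dest: injD)
qed

lemma eval_system_act_coord:
  assumes "i \<noteq> j"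
  shows "eval_mpoly (system_act P (matrix_unit i i - matrix_unit j j) 1) x = coord x i - coord x j"
proof -
  let ?d = "matrix_unit i i - matrix_unit j j :: 'a mat"
  have "eval_mpoly (system_act P ?d 1) x
      = (\<Sum>k\<in>UNIV. (?d $ Some k $ Some k - ?d $ None $ None) * x k)"
    by (subst system_act_diagonal) (auto simp: matrix_unit_def)
  also have "\<dots> = coord x i - coord x j"
  proof (cases i)
    case None
    then obtain j' where "j = Some j'" using assms by (cases j) auto
    then have "(\<Sum>k\<in>UNIV. (?d $ Some k $ Some k - ?d $ None $ None) * x k)
        = (\<Sum>k\<in>UNIV. - (if k = j' then x k else 0) - x k)"
      using None by (intro sum.cong) (auto simp: matrix_unit_def algebra_simps)
    then show ?thesis
      using None \<open>j = Some j'\<close> by (simp add: coord_def total_def sum_subtractf sum_negf)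
  next
    case (Some i')
    show ?thesis
    proof (cases j)
      case None
      have "(\<Sum>k\<in>UNIV. (?d $ Some k $ Some k - ?d $ None $ None) * x k)
          = (\<Sum>k\<in>UNIV. (if k = i' then x k else 0) + x k)"
        using Some None by (intro sum.cong) (auto simp: matrix_unit_def algebra_simps)
      then show ?thesis using Some None by (simp add: coord_def total_def sum.distrib)
    next
      case (Some j')
      have "(\<Sum>k\<in>UNIV. (?d $ Some k $ Some k - ?d $ None $ None) * x k)
          = (\<Sum>k\<in>UNIV. (if k = i' then x k else 0) - (if k = j' then x k else 0))"
        using \<open>i = Some i'\<close> Some by (intro sum.cong) (auto simp: matrix_unit_def algebra_simps)
      then show ?thesis using \<open>i = Some i'\<close> Some by (simp add: coord_def sum_subtractf)
    qed
  qed
  finally show ?thesis .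
qed

text \<open>The weight relations are the bracket relations of matrix units applied to the polynomial
  1.\<close>

lemma realises_weight_system:
  assumes V: "realises V \<Phi> P"
  shows "weight_system P"
proof
  fix i j k l :: "'a option" and x
  assume ne: "i \<noteq> j" "k \<noteq> l"
  let ?e = "matrix_unit :: 'a option \<Rightarrow> 'a option \<Rightarrow> 'a mat"
  have "eval_mpoly (P i j) x * eval_mpoly (P k l) (shift i j x)
      - eval_mpoly (P k l) x * eval_mpoly (P i j) (shift k l x)
    = eval_mpoly (system_act P (?e i j) (system_act P (?e k l) 1)
      - system_act P (?e k l) (system_act P (?e i j) 1)) x"
    using ne by (simp add: system_act_matrix_unit)
  also have "\<dots> = eval_mpoly (system_act P (bracket (?e i j) (?e k l)) 1) x"
    using ne by (simp add: realises_bracket[OF V] matrix_unit_in_sl)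
  also have "\<dots> = (if j = k \<and> i = l then coord x i - coord x j
       else if j = k then eval_mpoly (P i l) x
       else if i = l then - eval_mpoly (P k j) x else 0)"
  proof -
    have neg: "system_act P (- y) f = - system_act P y f" for y f
      using system_act_add[of P y "- y" f] system_act_diagonal[of 0 P f]
      by (simp add: add_eq_0_iff)
    show ?thesis
      using ne by (auto simp: bracket_matrix_unit eval_system_act_coord system_act_matrix_unit neg
          system_act_diagonal[of 0])
  qed
  finally show "eval_mpoly (P i j) x * eval_mpoly (P k l) (shift i j x)
      - eval_mpoly (P k l) x * eval_mpoly (P i j) (shift k l x)
    = (if j = k \<and> i = l then coord x i - coord x j
       else if j = k then eval_mpoly (P i l) x
       else if i = l then - eval_mpoly (P k j) x else 0)" .
qed

lemma realises_iso:
  assumes V: "realises V \<Phi> P" and W: "realises W \<Psi> P"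
  shows "slmod_iso V W"
proof -
  have bij: "bij \<Phi>" "bij \<Psi>" using V W by (simp_all add: realises_def)
  let ?f = "\<Psi> \<circ> inv \<Phi>"
  have f: "?f (\<Phi> p) = \<Psi> p" for p using bij by (simp add: bij_def)
  have surj: "\<exists>p. v = \<Phi> p" for v using bij by (metis bij_pointE)
  have vs: "vector_space (smult V)" "vector_space (smult W)"
    using V W by (simp_all add: realises_def is_slmod_def)
  have add: "?f (v + w) = ?f v + ?f w" for v w
  proof -
    obtain p q where "v = \<Phi> p" "w = \<Phi> q" using surj by metis
    moreover have "\<Phi> (p + q) = \<Phi> p + \<Phi> q" "\<Psi> (p + q) = \<Psi> p + \<Psi> q"
      using V W by (simp_all add: realises_def)
    ultimately show ?thesis using f by metis
  qed
  have scale: "?f (smult V c v) = smult W c (?f v)" for c v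
  proof -
    obtain p where "v = \<Phi> p" using surj by metis
    moreover have "\<Phi> (const c * p) = smult V c (\<Phi> p)" "\<Psi> (const c * p) = smult W c (\<Psi> p)"
      using V W by (simp_all add: realises_def)
    ultimately show ?thesis using f by metis
  qed
  have act: "?f (act V x v) = act W x (?f v)" if "x \<in> sl" for x v
  proof -
    obtain p where "v = \<Phi> p" using surj by metis
    moreover have "act V x (\<Phi> p) = \<Phi> (system_act P x p)" "act W x (\<Psi> p) = \<Psi> (system_act P x p)"
      using V W that by (simp_all add: realises_def)
    ultimately show ?thesis using f by metis
  qed
  have "Vector_Spaces.linear (smult V) (smult W) ?f"
    unfolding Vector_Spaces.linear_iff using vs add scale by blast
  then have "slmod_hom V W ?f" using act by (simp add: slmod_hom_def)
  moreover have "bij ?f" using bij by (intro bij_comp bij_imp_bij_inv)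
  ultimately show ?thesis by (auto simp: slmod_iso_def)
qed

lemma realises_category_M:
  assumes V: "realises V \<Phi> P"
  shows "V \<in> category_M"
proof -
  have bij: "bij \<Phi>" using V by (simp add: realises_def)
  define pact where "pact = (\<lambda>p v. \<Phi> (p * inv \<Phi> v))"
  have inv: "inv \<Phi> (\<Phi> p) = p" "\<Phi> (inv \<Phi> v) = v" for p v
    using bij by (simp_all add: bij_def surj_f_inv_f)
  have add: "\<Phi> (p + q) = \<Phi> p + \<Phi> q" for p q using V by (simp add: realises_def)
  have inv_add: "inv \<Phi> (v + w) = inv \<Phi> v + inv \<Phi> w" for v w
    using add[of "inv \<Phi> v" "inv \<Phi> w"] inv by metis
  interpret module pact
    by unfold_locales (simp_all add: pact_def inv inv_add add distrib_left distrib_right mult.assoc)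
  have "cartan_restriction V pact"
    unfolding cartan_restriction_def
  proof (intro conjI allI module_axioms)
    show "pact (const c) v = smult V c v" for c v
      using V inv(2)[of v] by (simp add: pact_def realises_def)
    show "pact (var k) v = act V (cartan_h k) v" for k v
    proof -
      have "act V (cartan_h k) (\<Phi> (inv \<Phi> v)) = \<Phi> (system_act P (cartan_h k) (inv \<Phi> v))"
        using V cartan_h_in_sl[of k] unfolding realises_def by blast
      then show ?thesis by (simp add: inv system_act_cartan_h pact_def)
    qed
  qed
  moreover have "free_rank_one pact"
    unfolding free_rank_one_def
  proof (intro exI[of _ "\<Phi> 1"] conjI)
    show "independent {\<Phi> 1}"
    proof
      assume "dependent {\<Phi> 1}"
      then obtain u where u: "u \<noteq> 0" "pact u (\<Phi> 1) = 0"
        unfolding dependent_finite[OF finite.insertI[OF finite.emptyI]] by auto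
      then have "\<Phi> u = \<Phi> 0" by (simp add: pact_def inv realises_additive[OF V])
      then have "u = 0" using bij by (metis inv(1))
      then show False using u by simp
    qed
    have "v \<in> range (\<lambda>p. pact p (\<Phi> 1))" for v
      by (rule range_eqI[of _ _ "inv \<Phi> v"]) (simp add: pact_def inv)
    then show "span {\<Phi> 1} = UNIV" unfolding span_singleton by blast
  qed
  ultimately show ?thesis using V by (auto simp: category_M_def realises_def)
qed

text \<open>Induction along multiplication by variables, matching what a map commuting with the
  action of the \<open>cartan_h k\<close> provides.\<close>

lemma mpoly_induct_var [case_names const var add]:
  fixes p :: "'n::finite mpoly"
  assumes const: "\<And>c. Q (const c)" and var: "\<And>k p. Q p \<Longrightarrow> Q (var k * p)"
    and add: "\<And>p q. Q p \<Longrightarrow> Q q \<Longrightarrow> Q (p + q)"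
  shows "Q p"
proof (induction p rule: mpoly_induct)
  case (single m c)
  have power: "Q (var k ^ e * p)" if "Q p" for k e p
    using that by (induction e) (simp_all add: var mult.assoc)
  have "Q ((\<Prod>k\<in>A. var k ^ Poly_Mapping.lookup m k) * const c)" if "finite A" for A
    using that by (induction A rule: finite_induct) (simp_all add: const power mult.assoc)
  from this[of UNIV] show ?case by (simp add: mpoly_single_eq mult.commute)
qed (rule add)

lemma bracket_cartan_h:
  "bracket (cartan_h k) (matrix_unit i j)
     = map_matrix ((*) ((if i = Some k then 1 else 0) - (if j = Some k then 1 else 0)))
         (matrix_unit i j :: 'n::finite mat)"
proof -
  let ?c = "\<lambda>p. (if p = Some k then 1 else 0) - 1 / of_nat (CARD('n) + 1) :: complex"
  have "(\<Sum>m\<in>UNIV. cartan_h k $ p $ m * matrix_unit i j $ m $ q)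
      = (\<Sum>m\<in>UNIV. if m = p then ?c p * matrix_unit i j $ p $ q else 0)" for p q
    by (intro sum.cong) (auto simp: cartan_h_nth)
  moreover have "(\<Sum>m\<in>UNIV. matrix_unit i j $ p $ m * cartan_h k $ m $ q)
      = (\<Sum>m\<in>UNIV. if m = q then ?c q * matrix_unit i j $ p $ q else 0)" for p q
    by (intro sum.cong) (auto simp: cartan_h_nth)
  ultimately have "bracket (cartan_h k) (matrix_unit i j) $ p $ q
      = (?c p - ?c q) * (matrix_unit i j :: 'n mat) $ p $ q" for p q
    by (simp add: bracket_def matrix_matrix_mult_def left_diff_distrib)
  then show ?thesis by (auto simp: vec_eq_iff) (auto simp: matrix_unit_def)
qed

text \<open>For a free generator \<open>v\<close> the map \<open>p \<mapsto> pact p v\<close> is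
  bijective. A matrix unit is an eigenvector of every \<open>cartan_h k\<close>, so moving it past a
  polynomial shifts the variables, and its action is determined by its value on
  \<open>v\<close>.\<close>

lemma category_M_realises:
  assumes "V \<in> category_M"
  obtains \<Phi> P where "realises V \<Phi> P"
proof -
  obtain pact v where V: "is_slmod V" and res: "cartan_restriction V pact"
    and ind: "\<not> module.dependent pact {v}" and span: "module.span pact {v} = UNIV"
    using assms unfolding category_M_def free_rank_one_def by blast
  interpret module pact using res by (simp add: cartan_restriction_def)
  define \<Phi> where "\<Phi> = (\<lambda>p. pact p v)"
  have \<Phi>_add: "\<Phi> (p + q) = \<Phi> p + \<Phi> q" for p q by (simp add: \<Phi>_def scale_left_distrib)
  have scale: "\<Phi> (const c * p) = smult V c (\<Phi> p)" for c p
    using res by (simp add: \<Phi>_def cartan_restriction_def flip: scale_scale)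
  have h: "act V (cartan_h k) (\<Phi> p) = \<Phi> (var k * p)" for k p
    using res by (simp add: \<Phi>_def cartan_restriction_def flip: scale_scale)
  have diff: "\<Phi> (p - q) = \<Phi> p - \<Phi> q" for p q by (simp add: \<Phi>_def scale_left_diff_distrib)
  have "surj \<Phi>" using span unfolding span_singleton \<Phi>_def .
  moreover have "inj \<Phi>"
  proof (rule injI)
    fix p q assume "\<Phi> p = \<Phi> q"
    then have 0: "pact (p - q) v = 0" by (simp add: \<Phi>_def scale_left_diff_distrib)
    show "p = q"
    proof (rule ccontr)
      assume "p \<noteq> q"
      then have "dependent {v}"
        unfolding dependent_finite[OF finite.insertI[OF finite.emptyI]]
        using 0 by (intro exI[of _ "\<lambda>_. p - q"]) simp
      then show False using ind by blast
    qed
  qed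
  ultimately have bij: "bij \<Phi>" by (simp add: bij_def)
  have lin: "act V x (u + w) = act V x u + act V x w" "act V x (smult V c w) = smult V c (act V x w)"
    if "x \<in> sl" for x u w c
    using V that by (simp_all add: is_slmod_def Vector_Spaces.linear_iff)
  have Vadd: "act V (x + y) w = act V x w + act V y w" if "x \<in> sl" "y \<in> sl" for x y w
    using V that by (simp add: is_slmod_def)
  have Vscale: "act V (map_matrix ((*) c) x) w = smult V c (act V x w)" if "x \<in> sl" for c x w
    using V that by (simp add: is_slmod_def)
  have Vbracket: "act V (bracket x y) w = act V x (act V y w) - act V y (act V x w)"
    if "x \<in> sl" "y \<in> sl" for x y w
    using V that by (simp add: is_slmod_def)
  define P where "P = (\<lambda>i j. inv \<Phi> (act V (matrix_unit i j) v))"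
  have P: "\<Phi> (P i j) = act V (matrix_unit i j) v" for i j
    using bij by (simp add: P_def bij_def surj_f_inv_f)
  have e: "act V (matrix_unit i j) (\<Phi> f) = \<Phi> (P i j * shift_poly i j f)" if ij: "i \<noteq> j" for i j f
  proof (induction f rule: mpoly_induct_var)
    case (const c)
    have "act V (matrix_unit i j) (\<Phi> (const c * 1)) = smult V c (act V (matrix_unit i j) (\<Phi> 1))"
      unfolding scale by (rule lin(2)) (rule matrix_unit_in_sl[OF ij])
    also have "act V (matrix_unit i j) (\<Phi> 1) = \<Phi> (P i j)" unfolding P by (simp add: \<Phi>_def)
    finally show ?case by (simp add: scale[symmetric] mult.commute)
  next
    case (add p q)
    then show ?case
      by (simp add: \<Phi>_add lin matrix_unit_in_sl[OF ij] shift_poly_add distrib_left)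
  next
    case (var k p)
    let ?c = "(if i = Some k then 1 else 0) - (if j = Some k then 1 else 0) :: complex"
    let ?e = "matrix_unit i j"
    \<comment> \<open>Here \<open>?c\<close> is the eigenvalue of \<open>cartan_h k\<close> on the
      matrix unit, so the shift of \<open>var k\<close> accounts for exactly the bracket
      term.\<close>
    have "shift_poly i j (var k) = var k - const ?c"
      by (rule mpoly_eqI) (auto simp: shift_def)
    then have s: "P i j * shift_poly i j (var k * p)
        = var k * (P i j * shift_poly i j p) - const ?c * (P i j * shift_poly i j p)"
      by (simp only: shift_poly_mult) (simp add: algebra_simps)
    have "smult V ?c (act V ?e (\<Phi> p)) = act V (bracket (cartan_h k) ?e) (\<Phi> p)"
      unfolding bracket_cartan_h by (rule Vscale[symmetric]) (rule matrix_unit_in_sl[OF ij])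
    also have "\<dots> = act V (cartan_h k) (act V ?e (\<Phi> p)) - act V ?e (act V (cartan_h k) (\<Phi> p))"
      by (rule Vbracket[OF cartan_h_in_sl matrix_unit_in_sl[OF ij]])
    finally have "act V ?e (\<Phi> (var k * p)) = \<Phi> (var k * (P i j * shift_poly i j p))
        - smult V ?c (\<Phi> (P i j * shift_poly i j p))"
      unfolding h var.IH by simp
    then show ?case unfolding s diff scale .
  qed
  have "act V x (\<Phi> f) = \<Phi> (system_act P x f)" if "x \<in> sl" for x f
  proof (rule sl_linear_extension[where A = "\<lambda>x. act V x (\<Phi> f)" and B = "\<lambda>x. \<Phi> (system_act P x f)"
        and s = "smult V" and x = x])
  qed (use that in \<open>simp_all add: Vadd Vscale system_act_add system_act_scale \<Phi>_add scale
      system_act_cartan_h h system_act_matrix_unit e\<close>)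
  then have "realises V \<Phi> P" using V bij \<Phi>_add scale by (simp add: realises_def)
  then show thesis by (rule that)
qed

text \<open>Read on polynomials, an isomorphism commutes with multiplication by all variables and
  scalars, so it is multiplication by \<open>T 1\<close>. Surjectivity makes \<open>T 1\<close> a
  unit, hence a constant; shifts do not move it and it cancels.\<close>

lemma realises_unique:
  assumes V: "realises V \<Phi> P" and W: "realises W \<Psi> Q" and iso: "slmod_iso V W" and "i \<noteq> j"
  shows "P i j = Q i j"
proof -
  obtain f where f: "slmod_hom V W f" "bij f" using iso by (auto simp: slmod_iso_def)
  have bij: "bij \<Phi>" "bij \<Psi>" using V W by (simp_all add: realises_def)
  define T where "T = inv \<Psi> \<circ> f \<circ> \<Phi>"
  have T: "\<Psi> (T p) = f (\<Phi> p)" for p using bij by (simp add: T_def bij_def surj_f_inv_f)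
  have bijT: "bij T" unfolding T_def using bij f(2) by (intro bij_comp bij_imp_bij_inv)
  have inj: "p = q" if "\<Psi> p = \<Psi> q" for p q using that bij by (auto simp: bij_def dest: injD)
  have act: "T (system_act P x p) = system_act Q x (T p)" if "x \<in> sl" for x p
  proof (rule inj)
    have "\<Psi> (T (system_act P x p)) = f (act V x (\<Phi> p))" using V that by (simp add: T realises_def)
    also have "\<dots> = act W x (f (\<Phi> p))" using f that by (simp add: slmod_hom_def)
    also have "\<dots> = \<Psi> (system_act Q x (T p))" using W that unfolding T[symmetric] by (simp add: realises_def)
    finally show "\<Psi> (T (system_act P x p)) = \<Psi> (system_act Q x (T p))" .
  qed
  have var: "T (var k * p) = var k * T p" for k p
    using act[OF cartan_h_in_sl, of k p] by (simp add: system_act_cartan_h)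
  have lin: "Vector_Spaces.linear (smult V) (smult W) f" using f by (simp add: slmod_hom_def)
  have T_const: "T (const c * p) = const c * T p" for c p
  proof (rule inj)
    have "\<Psi> (T (const c * p)) = f (smult V c (\<Phi> p))" using V by (simp add: T realises_def)
    also have "\<dots> = smult W c (f (\<Phi> p))" using lin by (simp add: Vector_Spaces.linear_iff)
    finally show "\<Psi> (T (const c * p)) = \<Psi> (const c * T p)" using W by (simp add: T realises_def)
  qed
  have add: "T (p + q) = T p + T q" for p q
  proof (rule inj)
    have "\<Psi> (T (p + q)) = f (\<Phi> p + \<Phi> q)" using V by (simp add: T realises_def)
    also have "\<dots> = f (\<Phi> p) + f (\<Phi> q)" using lin by (simp add: Vector_Spaces.linear_iff)
    finally show "\<Psi> (T (p + q)) = \<Psi> (T p + T q)" using W by (simp add: T realises_def)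
  qed
  have mult: "T p = p * T 1" for p
  proof (induction p rule: mpoly_induct_var)
    case (const c)
    then show ?case using T_const[of c 1] by simp
  qed (simp_all add: var add distrib_right mult.assoc)
  obtain q where q: "q * T 1 = 1" using bijT mult by (metis bij_pointE)
  have "eval_mpoly q x * eval_mpoly (T 1) x = 1" for x
    using arg_cong[OF q, of "\<lambda>p. eval_mpoly p x"] by simp
  then have nz: "eval_mpoly (T 1) x \<noteq> 0" for x by (metis mult_zero_right zero_neq_one)
  have c: "eval_mpoly (T 1) x = eval_mpoly (T 1) y" for x y
    by (rule polyfun_nonzero_const) (use nz in auto)
  have "T (P i j) = Q i j * shift_poly i j (T 1)"
    using act[OF matrix_unit_in_sl[OF \<open>i \<noteq> j\<close>], of 1] \<open>i \<noteq> j\<close> by (simp add: system_act_matrix_unit)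
  then have "P i j * T 1 = Q i j * shift_poly i j (T 1)" using mult[of "P i j"] by simp
  then have "eval_mpoly (P i j) x * eval_mpoly (T 1) x
      = eval_mpoly (Q i j) x * eval_mpoly (T 1) (shift i j x)" for x
    by (metis eval_mult eval_shift_poly)
  then have "eval_mpoly (P i j) x = eval_mpoly (Q i j) x" for x
    using c[of "shift i j x" x] nz[of x] mult_right_cancel by metis
  then show ?thesis by (rule mpoly_eqI)
qed

section \<open>Twisting by \<open>phi\<close> and \<open>tau\<close>\<close>

lemma is_slmod_twist:
  assumes V: "is_slmod V" and sl: "\<And>x. x \<in> sl \<Longrightarrow> \<phi> x \<in> sl"
    and add: "\<And>x y. \<phi> (x + y) = \<phi> x + \<phi> y"
    and scale: "\<And>c x. \<phi> (map_matrix ((*) c) x) = map_matrix ((*) c) (\<phi> x)"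
    and bracket: "\<And>x y. \<phi> (bracket x y) = bracket (\<phi> x) (\<phi> y)"
  shows "is_slmod (twist \<phi> V)"
  using V sl unfolding is_slmod_def
  by (simp add: twist_def add scale bracket sl_add sl_scale bracket_in_sl)

lemma phi_in_sl: "(\<And>i. a i \<noteq> 0) \<Longrightarrow> x \<in> sl \<Longrightarrow> phi a x \<in> sl"
  by (simp add: sl_def trace_def phi_def)

lemma phi_mult: "(\<And>i. a i \<noteq> 0) \<Longrightarrow> phi a (x ** y) = phi a x ** phi a y"
  by (simp add: phi_def matrix_matrix_mult_def vec_eq_iff sum_distrib_left field_simps)

text \<open>\<open>phi a\<close> fixes the diagonal, so the identification \<open>\<Phi>\<close> is
  kept and only the family is rescaled.\<close>

lemma realises_phi:
  assumes V: "realises V \<Phi> P" and a: "\<And>i. a i \<noteq> 0"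
  shows "realises (twist (phi a) V) \<Phi> (\<lambda>i j. const (a i / a j) * P i j)"
proof -
  have "is_slmod (twist (phi a) V)"
  proof (rule is_slmod_twist)
    show "is_slmod V" using V by (simp add: realises_def)
    have "phi a (x - y) = phi a x - phi a y" for x y :: "'a mat"
      by (simp add: phi_def vec_eq_iff algebra_simps)
    then show "phi a (bracket x y) = bracket (phi a x) (phi a y)" for x y :: "'a mat"
      by (simp add: bracket_def phi_mult a)
  qed (auto simp: phi_in_sl a, auto simp: phi_def vec_eq_iff algebra_simps)
  moreover have "system_act (\<lambda>i j. const (a i / a j) * P i j) x f = system_act P (phi a x) f" for x f
  proof -
    have "const (x $ i $ j) * (const (a i / a j) * P i j * shift_poly i j f)
        = const (phi a x $ i $ j) * (P i j * shift_poly i j f)" for i j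
      unfolding phi_def vec_lambda_beta by (simp only: const_mult mult_ac)
    moreover have "phi a x $ i $ i = x $ i $ i" for i using a by (simp add: phi_def)
    ultimately show ?thesis by (simp add: system_act_def)
  qed
  ultimately show ?thesis
    using V phi_in_sl[of a] a by (auto simp: realises_def twist_def)
qed

lemma tau_in_sl: "x \<in> sl \<Longrightarrow> tau x \<in> sl"
  by (simp add: sl_def trace_def tau_def transpose_def sum_negf)

lemma negate_add: "negate (p + q) = negate p + negate q"
  and negate_mult: "negate (p * q) = negate p * negate q"
  and negate_const: "negate (const c) = const c"
  by (rule mpoly_eqI, simp)+

lemma negate_sum: "negate (\<Sum>i\<in>A. f i) = (\<Sum>i\<in>A. negate (f i))"
  by (rule mpoly_eqI) simp

lemma sum_off_diagonal_swap:
  "(\<Sum>i\<in>UNIV. \<Sum>j\<in>UNIV - {i}. f i j) = (\<Sum>i\<in>UNIV. \<Sum>j\<in>UNIV - {i}. f j i)"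
  for f :: "'a::finite \<Rightarrow> 'a \<Rightarrow> 'b::comm_monoid_add"
proof -
  have "(\<Sum>i\<in>UNIV. \<Sum>j\<in>UNIV - {i}. f i j) = (\<Sum>i\<in>UNIV. \<Sum>j\<in>UNIV. if i = j then 0 else f i j)" for f :: "'a \<Rightarrow> 'a \<Rightarrow> 'b"
    by (intro sum.cong sum.mono_neutral_cong_left) auto
  note * = this
  show ?thesis unfolding * by (subst sum.swap) (auto intro!: sum.cong)
qed

lemma system_act_dual: "system_act P (tau x) (negate f) = negate (system_act (dual P) x f)"
proof -
  have "(\<Sum>i\<in>UNIV. \<Sum>j\<in>UNIV - {i}. const (tau x $ i $ j) * (P i j * shift_poly i j (negate f)))
    = (\<Sum>i\<in>UNIV. \<Sum>j\<in>UNIV - {i}. const (tau x $ j $ i) * (P j i * shift_poly j i (negate f)))"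
    by (rule sum_off_diagonal_swap)
  also have "\<dots> = negate (\<Sum>i\<in>UNIV. \<Sum>j\<in>UNIV - {i}. const (x $ i $ j) * (dual P i j * shift_poly i j f))"
    unfolding negate_sum
    by (intro sum.cong refl mpoly_eqI) (simp add: tau_def transpose_def shift_uminus)
  finally have off: "(\<Sum>i\<in>UNIV. \<Sum>j\<in>UNIV - {i}. const (tau x $ i $ j) * (P i j * shift_poly i j (negate f)))
    = negate (\<Sum>i\<in>UNIV. \<Sum>j\<in>UNIV - {i}. const (x $ i $ j) * (dual P i j * shift_poly i j f))" .
  have "(\<Sum>k\<in>UNIV. const (tau x $ Some k $ Some k - tau x $ None $ None) * (var k * negate f))
    = negate (\<Sum>k\<in>UNIV. const (x $ Some k $ Some k - x $ None $ None) * (var k * f))"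
    unfolding negate_sum
    by (intro sum.cong refl mpoly_eqI) (simp add: tau_def transpose_def algebra_simps)
  with off show ?thesis by (simp add: system_act_def negate_add)
qed

text \<open>\<open>tau\<close> changes the sign of the Cartan subalgebra, so \<open>\<Phi>\<close>
  has to be composed with \<open>negate\<close> for \<open>cartan_h k\<close> to act again as
  multiplication by \<open>var k\<close>.\<close>

lemma realises_tau:
  assumes V: "realises V \<Phi> P"
  shows "realises (twist tau V) (\<Phi> \<circ> negate) (dual P)"
proof -
  have "is_slmod (twist tau V)"
  proof (rule is_slmod_twist)
    show "is_slmod V" using V by (simp add: realises_def)
    show "tau (bracket x y) = bracket (tau x) (tau y)" for x y :: "'a mat"
      by (simp add: tau_def bracket_def matrix_transpose_mul vec_eq_iff matrix_matrix_mult_def transpose_def sum_negf mult.commute)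
  qed (auto simp: tau_in_sl, auto simp: tau_def transpose_def vec_eq_iff)
  moreover have "bij (\<Phi> \<circ> negate)"
  proof (rule bij_comp)
    show "bij (negate :: 'a mpoly \<Rightarrow> _)" by (rule o_bij[of negate]) auto
    show "bij \<Phi>" using V by (simp add: realises_def)
  qed
  ultimately show ?thesis
    using V by (auto simp: realises_def twist_def negate_add negate_mult negate_const
        tau_in_sl simp flip: system_act_dual)
qed

section \<open>The modules \<open>M\<^sub>b\<^sup>S\<close> are modules\<close>

fun unit_poly :: "'n::finite set \<Rightarrow> complex \<Rightarrow> 'n option \<Rightarrow> 'n option \<Rightarrow> 'n mpoly" where
  "unit_poly S b (Some i) None = (hbar + const b) * u_poly S b i"
| "unit_poly S b None (Some j) = - w_poly S b j"
| "unit_poly S b (Some i) (Some j) = u_poly S b i * w_poly S b j"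
| "unit_poly S b None None = 0"

lemma eval_sigma [simp]: "eval_mpoly (sigma i f) x = eval_mpoly f (x(i := x i - 1))"
  unfolding sigma_def eval_subst
  by (rule arg_cong[where f = "eval_mpoly f"]) auto

lemma eval_inv_sigma [simp]: "eval_mpoly (inv (sigma i) f) x = eval_mpoly f (x(i := x i + 1))"
  unfolding inv_sigma eval_subst
  by (rule arg_cong[where f = "eval_mpoly f"]) auto

lemma eval_hbar [simp]: "eval_mpoly hbar x = total x"
  by (simp add: hbar_def total_def)

lemma eval_u_poly: "eval_mpoly (u_poly S b i) x = (if i \<in> S then 1 else x i - b - 1)"
  and eval_w_poly: "eval_mpoly (w_poly S b i) x = (if i \<in> S then x i - b else 1)"
  by (simp_all add: u_poly_def w_poly_def)

lemma unit_act_eq: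
  assumes "i \<noteq> j"
  shows "unit_act S b i j f = unit_poly S b i j * shift_poly i j f"
proof (cases i; cases j)
  fix k l assume "i = Some k" "j = Some l"
  then show ?thesis using assms
    by (intro mpoly_eqI) (simp add: shift_Some_Some fun_upd_twist)
qed (use assms in \<open>auto intro!: mpoly_eqI simp: shift_simps\<close>)

lemma act_module_M: "x \<in> sl \<Longrightarrow> act (module_M S b) x f = system_act (unit_poly S b) x f"
  unfolding module_M_def system_act_def by (auto intro!: sum.cong simp: unit_act_eq)

text \<open>\<open>gl_act\<close> is the embedding of \<open>gl\<close> into the Weyl algebra by vector fields on projective
  space; \<open>euler\<close> is a shifted Euler field.\<close>

definition creation :: "'n::finite set \<Rightarrow> complex \<Rightarrow> 'n \<Rightarrow> 'n mpoly \<Rightarrow> 'n mpoly" where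
  "creation S b i f = u_poly S b i * sigma i f"

definition annihilation :: "'n::finite set \<Rightarrow> complex \<Rightarrow> 'n \<Rightarrow> 'n mpoly \<Rightarrow> 'n mpoly" where
  "annihilation S b j f = w_poly S b j * inv (sigma j) f"

definition euler :: "complex \<Rightarrow> 'n::finite mpoly \<Rightarrow> 'n mpoly" where
  "euler b f = (hbar + const b + 1) * f"

lemma eval_creation: "eval_mpoly (creation S b i f) x
    = (if i \<in> S then 1 else x i - b - 1) * eval_mpoly f (x(i := x i - 1))"
  and eval_annihilation: "eval_mpoly (annihilation S b i f) x
    = (if i \<in> S then x i - b else 1) * eval_mpoly f (x(i := x i + 1))"
  and eval_euler: "eval_mpoly (euler b f) x = (total x + b + 1) * eval_mpoly f x"
  by (simp_all add: creation_def annihilation_def euler_def eval_u_poly eval_w_poly)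

lemmas eval_operators = eval_creation eval_annihilation eval_euler

section \<open>Weyl algebra relations\<close>

lemma creation_creation: "creation S b i (creation S b j f) = creation S b j (creation S b i f)"
  by (cases "i = j") (auto intro!: mpoly_eqI simp: eval_operators fun_upd_twist)

lemma annihilation_annihilation:
  "annihilation S b i (annihilation S b j f) = annihilation S b j (annihilation S b i f)"
  by (cases "i = j") (auto intro!: mpoly_eqI simp: eval_operators fun_upd_twist)

text \<open>Whether or not \<open>i\<close> lies in \<open>S\<close>, creation after annihilation is
  multiplication by \<open>var i - const b - 1\<close>; \<open>S\<close> only decides which of the
  two operators carries a polynomial factor. This is why the verification is uniform in
  \<open>S\<close>.\<close>

lemma annihilation_creation:
  "annihilation S b j (creation S b i f)
     = creation S b i (annihilation S b j f) + (if i = j then f else 0)"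
  by (cases "i = j") (auto intro!: mpoly_eqI simp: eval_operators fun_upd_twist algebra_simps)

lemma euler_creation: "euler b (creation S b i f) = creation S b i (euler b f) + creation S b i f"
  by (rule mpoly_eqI) (simp add: eval_operators total_upd algebra_simps)

lemma euler_annihilation:
  "euler b (annihilation S b i f) = annihilation S b i (euler b f) - annihilation S b i f"
  by (rule mpoly_eqI) (simp add: eval_operators total_upd algebra_simps)

lemma creation_linear:
  "creation S b i (f + g) = creation S b i f + creation S b i g"
  "creation S b i (f - g) = creation S b i f - creation S b i g"
  "creation S b i (- f) = - creation S b i f"
  "creation S b i (const c * f) = const c * creation S b i f"
  "creation S b i 0 = 0"
  by (rule mpoly_eqI, simp add: eval_operators algebra_simps)+

lemma annihilation_linear:
  "annihilation S b i (f + g) = annihilation S b i f + annihilation S b i g"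
  "annihilation S b i (f - g) = annihilation S b i f - annihilation S b i g"
  "annihilation S b i (- f) = - annihilation S b i f"
  "annihilation S b i (const c * f) = const c * annihilation S b i f"
  "annihilation S b i 0 = 0"
  by (rule mpoly_eqI, simp add: eval_operators algebra_simps)+

lemma euler_linear:
  "euler b (f + g) = euler b f + euler b g"
  "euler b (f - g) = euler b f - euler b g"
  "euler b (- f) = - euler b f"
  "euler b (const c * f) = const c * euler b f"
  "euler b 0 = 0"
  by (rule mpoly_eqI, simp add: eval_operators algebra_simps)+

fun gl_act :: "'n::finite set \<Rightarrow> complex \<Rightarrow> 'n option \<Rightarrow> 'n option \<Rightarrow> 'n mpoly \<Rightarrow> 'n mpoly" where
  "gl_act S b (Some i) (Some j) f = creation S b i (annihilation S b j f)"
| "gl_act S b (Some i) None f = creation S b i (euler b f)"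
| "gl_act S b None (Some j) f = - annihilation S b j f"
| "gl_act S b None None f = - euler b f"

lemma gl_act_add: "gl_act S b i j (f + g) = gl_act S b i j f + gl_act S b i j g"
  by (cases i; cases j) (simp_all add: creation_linear annihilation_linear euler_linear)

lemma gl_act_scale: "gl_act S b i j (const c * f) = const c * gl_act S b i j f"
  by (cases i; cases j) (simp_all add: creation_linear annihilation_linear euler_linear)

lemma gl_act_0: "gl_act S b i j 0 = 0"
  using gl_act_scale[of S b i j 0 0] by simp

lemma gl_act_sum: "gl_act S b i j (\<Sum>k\<in>A. f k) = (\<Sum>k\<in>A. gl_act S b i j (f k))"
  by (induction A rule: infinite_finite_induct) (simp_all add: gl_act_add gl_act_0)

text \<open>Including the diagonal matrix units gives a single formula for all brackets, with no
  separate treatment of \<open>i = l\<close> and \<open>j = k\<close>.\<close>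

lemma gl_act_commutator:
  "gl_act S b i j (gl_act S b k l f) - gl_act S b k l (gl_act S b i j f)
     = (if j = k then gl_act S b i l f else 0) - (if l = i then gl_act S b k j f else 0)"
  by (cases i; cases j; cases k; cases l)
    (simp_all add: creation_linear annihilation_linear euler_linear annihilation_creation
      euler_creation euler_annihilation creation_creation annihilation_annihilation)

text \<open>The \<open>+ 1\<close> in \<open>euler\<close> is absorbed when the outer creation
  operator lowers the \<open>total\<close> by one, leaving the factor
  \<open>hbar + const b\<close>.\<close>

lemma gl_act_off_diagonal:
  assumes "i \<noteq> j"
  shows "gl_act S b i j f = unit_poly S b i j * shift_poly i j f"
  unfolding unit_act_eq[OF assms, symmetric]
  using assms
  by (cases i; cases j)
    (auto intro!: mpoly_eqI simp: eval_operators eval_u_poly eval_w_poly total_upd fun_upd_twist)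

lemma gl_act_diagonal:
  "gl_act S b (Some k) (Some k) f = (var k - const (b + 1)) * f"
  "gl_act S b None None f = - ((hbar + const (b + 1)) * f)"
  by (rule mpoly_eqI, auto simp: eval_operators algebra_simps)+

text \<open>Relative to the Cartan weights, all n + 1 diagonal units are shifted by the same scalar
  \<open>- (b + 1)\<close>, and the trace condition removes this shift.\<close>

lemma system_act_gl_act:
  assumes "x \<in> sl"
  shows "system_act (unit_poly S b) x f = (\<Sum>i\<in>UNIV. \<Sum>j\<in>UNIV. const (x $ i $ j) * gl_act S b i j f)"
proof -
  let ?E = "\<Sum>i\<in>UNIV. \<Sum>j\<in>UNIV - {i}. const (x $ i $ j) * (unit_poly S b i j * shift_poly i j f)"
  have tr: "x $ None $ None + (\<Sum>k\<in>UNIV. x $ Some k $ Some k) = 0"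
    using assms by (simp add: sl_def trace_def sum_UNIV_option)
  have "(\<Sum>i\<in>UNIV. \<Sum>j\<in>UNIV. const (x $ i $ j) * gl_act S b i j f)
      = (\<Sum>i\<in>UNIV. const (x $ i $ i) * gl_act S b i i f
          + (\<Sum>j\<in>UNIV - {i}. const (x $ i $ j) * (unit_poly S b i j * shift_poly i j f)))"
  proof (rule sum.cong[OF refl])
    fix i
    have "(\<Sum>j\<in>UNIV - {i}. const (x $ i $ j) * gl_act S b i j f)
        = (\<Sum>j\<in>UNIV - {i}. const (x $ i $ j) * (unit_poly S b i j * shift_poly i j f))"
      by (intro sum.cong refl) (simp add: gl_act_off_diagonal)
    then show "(\<Sum>j\<in>UNIV. const (x $ i $ j) * gl_act S b i j f)
        = const (x $ i $ i) * gl_act S b i i f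
          + (\<Sum>j\<in>UNIV - {i}. const (x $ i $ j) * (unit_poly S b i j * shift_poly i j f))"
      by (simp add: sum.remove[of UNIV i])
  qed
  also have "\<dots> = (\<Sum>i\<in>UNIV. const (x $ i $ i) * gl_act S b i i f) + ?E"
    by (rule sum.distrib)
  also have "(\<Sum>i\<in>UNIV. const (x $ i $ i) * gl_act S b i i f)
      = (\<Sum>k\<in>UNIV. const (x $ Some k $ Some k - x $ None $ None) * (var k * f))"
  proof (rule mpoly_eqI)
    fix y
    let ?f = "eval_mpoly f y"
    have "eval_mpoly (\<Sum>i\<in>UNIV. const (x $ i $ i) * gl_act S b i i f) y
      = (\<Sum>k\<in>UNIV. x $ Some k $ Some k * ((y k - (b + 1)) * ?f)) - x $ None $ None * ((total y + (b + 1)) * ?f)"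
      by (simp add: sum_UNIV_option gl_act_diagonal del: gl_act.simps)
    also have "\<dots> = (\<Sum>k\<in>UNIV. (x $ Some k $ Some k - x $ None $ None) * (y k * ?f))
      - (x $ None $ None + (\<Sum>k\<in>UNIV. x $ Some k $ Some k)) * ((b + 1) * ?f)"
      by (simp add: total_def algebra_simps sum_subtractf sum.distrib sum_distrib_left sum_distrib_right)
    finally show "eval_mpoly (\<Sum>i\<in>UNIV. const (x $ i $ i) * gl_act S b i i f) y
      = eval_mpoly (\<Sum>k\<in>UNIV. const (x $ Some k $ Some k - x $ None $ None) * (var k * f)) y"
      unfolding tr by simp
  qed
  finally show ?thesis by (simp add: system_act_def)
qed

text \<open>Both products are expanded over four indices and brought to the same order of summation.
  The commutator formula then collapses one index, and the coefficients become the entries of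
  \<open>x ** y\<close> and \<open>y ** x\<close>.\<close>

lemma system_act_unit_poly_bracket:
  assumes "x \<in> sl" "y \<in> sl"
  shows "system_act (unit_poly S b) (bracket x y) f
    = system_act (unit_poly S b) x (system_act (unit_poly S b) y f)
      - system_act (unit_poly S b) y (system_act (unit_poly S b) x f)"
proof -
  let ?G = "gl_act S b"
  let ?c = "\<lambda>i j k l. const (x $ i $ j * y $ k $ l)"
  have 1: "system_act (unit_poly S b) x (system_act (unit_poly S b) y f)
      = (\<Sum>i\<in>UNIV. \<Sum>j\<in>UNIV. \<Sum>k\<in>UNIV. \<Sum>l\<in>UNIV. ?c i j k l * ?G i j (?G k l f))"
    using assms by (simp add: system_act_gl_act gl_act_sum gl_act_scale sum_distrib_left const_mult mult.assoc)
  have "system_act (unit_poly S b) y (system_act (unit_poly S b) x f)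
      = (\<Sum>k\<in>UNIV. \<Sum>l\<in>UNIV. \<Sum>i\<in>UNIV. \<Sum>j\<in>UNIV. ?c i j k l * ?G k l (?G i j f))"
    using assms by (simp add: system_act_gl_act gl_act_sum gl_act_scale sum_distrib_left const_mult mult_ac)
  also have "\<dots> = (\<Sum>k\<in>UNIV. \<Sum>i\<in>UNIV. \<Sum>l\<in>UNIV. \<Sum>j\<in>UNIV. ?c i j k l * ?G k l (?G i j f))"
    by (intro sum.cong refl sum.swap)
  also have "\<dots> = (\<Sum>i\<in>UNIV. \<Sum>k\<in>UNIV. \<Sum>l\<in>UNIV. \<Sum>j\<in>UNIV. ?c i j k l * ?G k l (?G i j f))"
    by (rule sum.swap)
  also have "\<dots> = (\<Sum>i\<in>UNIV. \<Sum>k\<in>UNIV. \<Sum>j\<in>UNIV. \<Sum>l\<in>UNIV. ?c i j k l * ?G k l (?G i j f))"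
    by (intro sum.cong refl sum.swap)
  also have "\<dots> = (\<Sum>i\<in>UNIV. \<Sum>j\<in>UNIV. \<Sum>k\<in>UNIV. \<Sum>l\<in>UNIV. ?c i j k l * ?G k l (?G i j f))"
    by (intro sum.cong refl sum.swap)
  finally have 2: "system_act (unit_poly S b) y (system_act (unit_poly S b) x f) = \<dots>" .
  have "system_act (unit_poly S b) x (system_act (unit_poly S b) y f)
      - system_act (unit_poly S b) y (system_act (unit_poly S b) x f)
    = (\<Sum>i\<in>UNIV. \<Sum>j\<in>UNIV. \<Sum>k\<in>UNIV. \<Sum>l\<in>UNIV.
        ?c i j k l * ((if j = k then ?G i l f else 0) - (if l = i then ?G k j f else 0)))"
    unfolding 1 2 gl_act_commutator[symmetric] by (simp add: sum_subtractf right_diff_distrib)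
  also have "\<dots> = (\<Sum>i\<in>UNIV. \<Sum>j\<in>UNIV. \<Sum>k\<in>UNIV. \<Sum>l\<in>UNIV. if j = k then ?c i j k l * ?G i l f else 0)
      - (\<Sum>i\<in>UNIV. \<Sum>j\<in>UNIV. \<Sum>k\<in>UNIV. \<Sum>l\<in>UNIV. if l = i then ?c i j k l * ?G k j f else 0)"
    unfolding sum_subtractf[symmetric] by (intro sum.cong refl) (simp add: right_diff_distrib)
  also have "(\<Sum>i\<in>UNIV. \<Sum>j\<in>UNIV. \<Sum>k\<in>UNIV. \<Sum>l\<in>UNIV. if j = k then ?c i j k l * ?G i l f else 0)
      = (\<Sum>i\<in>UNIV. \<Sum>l\<in>UNIV. const ((x ** y) $ i $ l) * ?G i l f)"
  proof (rule sum.cong[OF refl])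
    fix i
    have "(\<Sum>j\<in>UNIV. \<Sum>k\<in>UNIV. \<Sum>l\<in>UNIV. if j = k then ?c i j k l * ?G i l f else 0)
        = (\<Sum>j\<in>UNIV. \<Sum>k\<in>UNIV. if j = k then (\<Sum>l\<in>UNIV. ?c i j j l * ?G i l f) else 0)"
      by (intro sum.cong refl) auto
    also have "\<dots> = (\<Sum>j\<in>UNIV. \<Sum>l\<in>UNIV. ?c i j j l * ?G i l f)" by simp
    also have "\<dots> = (\<Sum>l\<in>UNIV. \<Sum>j\<in>UNIV. ?c i j j l * ?G i l f)" by (rule sum.swap)
    also have "\<dots> = (\<Sum>l\<in>UNIV. const ((x ** y) $ i $ l) * ?G i l f)"
      by (simp add: matrix_matrix_mult_def const_sum sum_distrib_right)
    finally show "(\<Sum>j\<in>UNIV. \<Sum>k\<in>UNIV. \<Sum>l\<in>UNIV. if j = k then ?c i j k l * ?G i l f else 0) = \<dots>" .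
  qed
  also have "(\<Sum>i\<in>UNIV. \<Sum>j\<in>UNIV. \<Sum>k\<in>UNIV. \<Sum>l\<in>UNIV. if l = i then ?c i j k l * ?G k j f else 0)
      = (\<Sum>i\<in>UNIV. \<Sum>j\<in>UNIV. \<Sum>k\<in>UNIV. ?c i j k i * ?G k j f)" by simp
  also have "\<dots> = (\<Sum>i\<in>UNIV. \<Sum>k\<in>UNIV. \<Sum>j\<in>UNIV. ?c i j k i * ?G k j f)"
    by (intro sum.cong refl sum.swap)
  also have "\<dots> = (\<Sum>k\<in>UNIV. \<Sum>i\<in>UNIV. \<Sum>j\<in>UNIV. ?c i j k i * ?G k j f)" by (rule sum.swap)
  also have "\<dots> = (\<Sum>k\<in>UNIV. \<Sum>j\<in>UNIV. \<Sum>i\<in>UNIV. ?c i j k i * ?G k j f)"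
    by (intro sum.cong refl sum.swap)
  also have "\<dots> = (\<Sum>k\<in>UNIV. \<Sum>j\<in>UNIV. const ((y ** x) $ k $ j) * ?G k j f)"
    by (simp add: matrix_matrix_mult_def const_sum sum_distrib_right mult.commute[of "x $ _ $ _"])
  finally have "system_act (unit_poly S b) x (system_act (unit_poly S b) y f)
      - system_act (unit_poly S b) y (system_act (unit_poly S b) x f)
    = (\<Sum>i\<in>UNIV. \<Sum>j\<in>UNIV. (const ((x ** y) $ i $ j) - const ((y ** x) $ i $ j)) * ?G i j f)"
    by (simp add: sum_subtractf left_diff_distrib)
  moreover have "const c - const d = (const (c - d) :: 'a mpoly)" for c d
    by (metis add_diff_cancel const_add diff_add_cancel)
  ultimately show ?thesis by (simp add: system_act_gl_act bracket_in_sl) (simp add: bracket_def)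
qed

lemma realises_module_M: "realises (module_M S b) (\<lambda>p. p) (unit_poly S b)"
proof -
  have smult: "smult (module_M S b) = (\<lambda>c f. const c * f)" by (simp add: module_M_def)
  have vs: "vector_space (\<lambda>c (f :: 'a mpoly). const c * f)"
    by unfold_locales (simp_all add: distrib_left distrib_right const_add const_mult mult.assoc)
  have "act (module_M S b) \<in> extensional sl" by (simp add: module_M_def)
  then have "is_slmod (module_M S b)"
    unfolding is_slmod_def smult Vector_Spaces.linear_iff using vs
    by (simp add: act_module_M system_act_add system_act_scale system_act_add_right
        system_act_scale_right system_act_unit_poly_bracket sl_add sl_scale bracket_in_sl)
  then show ?thesis by (simp add: realises_def smult act_module_M bij_def)
qed

section \<open>The skeleton\<close>

abbreviation extend :: "('n \<Rightarrow> complex) \<Rightarrow> 'n option \<Rightarrow> complex" where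
  "extend a \<equiv> case_option 1 a"

lemma extend_nonzero: "(\<And>i. a i \<noteq> 0) \<Longrightarrow> extend a j \<noteq> 0"
  by (cases j) auto

lemma standard_twist:
  assumes "\<And>i. a i \<noteq> 0"
  shows "standard (\<lambda>i j. const (extend a i / extend a j) * unit_poly S b i j) a S b"
  using assms by (auto simp: standard_def up_def dn_def eval_u_poly eval_w_poly field_simps)

lemma realises_twist:
  assumes "\<And>i. a i \<noteq> 0"
  shows "realises (twist (phi (extend a)) (module_M S b)) (\<lambda>p. p)
    (\<lambda>i j. const (extend a i / extend a j) * unit_poly S b i j)"
  by (rule realises_phi[OF realises_module_M]) (rule extend_nonzero[OF assms])

lemma dual_scale:
  "dual (\<lambda>i j. const (a i / a j) * P i j)
     = (\<lambda>i j. const ((1 / a i) / (1 / a j)) * dual P i j)"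
  by (intro ext mpoly_eqI) simp

text \<open>Duality interchanges the indices and so inverts the ratios \<open>a i / a j\<close>; the
  twist that realises the dual family therefore uses the reciprocals.\<close>

lemma realises_twist_tau:
  assumes "\<And>i. a i \<noteq> 0"
  shows "realises (twist (phi (extend (\<lambda>i. 1 / a i))) (twist tau (module_M S b))) negate
    (dual (\<lambda>i j. const (extend a i / extend a j) * unit_poly S b i j))"
proof -
  have ext: "extend (\<lambda>i. 1 / a i) = (\<lambda>i. 1 / extend a i)"
    by (rule ext) (simp split: option.split)
  have "realises (twist tau (module_M S b)) negate (dual (unit_poly S b))"
    using realises_tau[OF realises_module_M] by (simp add: comp_def)
  then show ?thesis
    unfolding dual_scale ext using extend_nonzero[of a, OF assms] by (intro realises_phi) auto
qed

text \<open>The entries with two indices in \<open>Some\<close> are commutators of an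
  \<open>up\<close> and a \<open>dn\<close>, by \<open>up_dn_diff\<close>.\<close>

lemma standard_determines:
  assumes P: "weight_system P" and Q: "weight_system Q"
    and "standard P a S b" "standard Q a S b" and "i \<noteq> j"
  shows "P i j = Q i j"
proof (rule mpoly_eqI)
  fix x
  have up: "up P k = up Q k" and dn: "dn P k = dn Q k" for k
    using assms(3,4) by (simp_all add: fun_eq_iff standard_def)
  interpret P: weight_system P by fact
  interpret Q: weight_system Q by fact
  show "eval_mpoly (P i j) x = eval_mpoly (Q i j) x"
  proof (cases i; cases j)
    fix k l assume kl: "i = Some k" "j = Some l"
    then have "k \<noteq> l" using \<open>i \<noteq> j\<close> by simp
    then show ?thesis
      using P.up_dn_diff[of k l x] Q.up_dn_diff[of k l x] unfolding kl up dn by simp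
  qed (use \<open>i \<noteq> j\<close> up dn in \<open>auto simp: up_def dn_def\<close>)
qed

text \<open>\<open>dn P i\<close> depends on \<open>x i\<close> exactly when
  \<open>i \<in> S\<close>, and its slope or constant value gives \<open>a i\<close>. For nonempty
  \<open>S\<close> it also gives \<open>b\<close>; for empty \<open>S\<close> this is read off from
  \<open>up P i\<close> at two points, the second of which needs another index
  \<open>j\<close>.\<close>

lemma standard_unique:
  fixes P :: "'n::finite option \<Rightarrow> 'n option \<Rightarrow> 'n mpoly"
  assumes card: "CARD('n) > 1" and P: "standard P a S b" and Q: "standard P a' S' b'"
  shows "a = a' \<and> S = S' \<and> b = b'"
proof -
  have dn: "(if i \<in> S then t - b else 1) / a i = (if i \<in> S' then t - b' else 1) / a' i" for i t
  proof -
    have "- (if i \<in> S then t - b else 1) / a i = - (if i \<in> S' then t - b' else 1) / a' i"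
      using P Q unfolding standard_def by (metis (no_types) fun_upd_same)
    then show ?thesis by (simp add: minus_divide_left[symmetric])
  qed
  have nz: "a i \<noteq> 0" "a' i \<noteq> 0" for i using P Q by (auto simp: standard_def)
  have S: "i \<in> S \<longleftrightarrow> i \<in> S'" for i
    using dn[of i b] dn[of i "b + 1"] dn[of i b'] dn[of i "b' + 1"] nz[of i]
    by (auto split: if_splits)
  have "a i = a' i" for i
    using dn[of i 0] dn[of i 1] nz[of i] S[of i]
    by (cases "i \<in> S") (auto simp: field_simps)
  then have a: "a = a'" by auto
  have "b = b'"
  proof (cases "S = {}")
    case False
    then obtain i where "i \<in> S" by blast
    then show ?thesis using dn[of i 0] S[of i] a nz[of i] by simp
  next
    case True
    obtain i j :: 'n where ij: "i \<noteq> j"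
      using card card_le_Suc0_iff_eq[of "UNIV :: 'n set"] by auto
    have z: "total (\<lambda>_::'n. 0) = 0" by (simp add: total_def)
    have up: "(total x + b) * (x i - b - 1) = (total x + b') * (x i - b' - 1)" for x
    proof -
      have "a i * ((total x + b) * (x i - b - 1)) = a i * ((total x + b') * (x i - b' - 1))"
        using P Q True S a by (simp add: standard_def)
      then show ?thesis using nz[of i] by simp
    qed
    have "(1 + b) * b = (1 + b') * b'" "b * b = b' * b'"
      using up[of "(\<lambda>_. 0)(i := 1)"] up[of "(\<lambda>_. 0)(i := 1, j := - 1)"] ij
      by (simp_all add: total_upd z)
    then show ?thesis by algebra
  qed
  with a S show ?thesis by auto
qed

text \<open>In the standard form \<open>up P i\<close> depends on every variable, while for a
  standard dual it is a function of \<open>x i\<close> alone; a second index separates the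
  two.\<close>

lemma standard_dual_False:
  fixes P :: "'n::finite option \<Rightarrow> 'n option \<Rightarrow> 'n mpoly"
  assumes card: "CARD('n) > 1" and P: "standard P a S b" and Q: "standard (dual P) a' S' b'"
  shows False
proof -
  obtain i j :: 'n where ij: "i \<noteq> j"
    using card card_le_Suc0_iff_eq[of "UNIV :: 'n set"] by auto
  have up: "up P i x = a i * ((total x + b) * (if i \<in> S then 1 else x i - b - 1))" for x
    using P by (simp add: standard_def)
  have "up P i (\<lambda>k. - x k) = (if i \<in> S' then x i - b' else 1) / a' i" for x
    using Q dn_dual[of P i x] by (simp add: standard_def)
  from this[of "\<lambda>k. - x k" for x]
  have up': "up P i x = (if i \<in> S' then - x i - b' else 1) / a' i" for x by simp
  \<comment> \<open>At \<open>x i = b + 2\<close> the factor \<open>x i - b - 1\<close> equals 1, so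
    both cases for \<open>i \<in> S\<close> have a nonzero step in direction
    \<open>j\<close>.\<close>
  let ?x = "(\<lambda>_. 0)(i := b + 2)"
  have "up P i ?x = up P i (?x(j := 1))" unfolding up' using ij by simp
  then have "a i = 0" unfolding up using ij by (simp add: total_upd algebra_simps split: if_splits)
  then show False using P by (simp add: standard_def)
qed

text \<open>The second case is parametrised by reciprocals so that its \<open>a\<close> is the
  parameter of the standard form of the dual family.\<close>

lemma category_S_cases:
  assumes "X \<in> category_S"
  obtains a S b where "\<And>i. a i \<noteq> 0" "X = twist (phi (extend a)) (module_M S b)"
  | a S b where "\<And>i. a i \<noteq> 0"
      "X = twist (phi (extend (\<lambda>i. 1 / a i))) (twist tau (module_M S b))"
proof -
  have ext: "a = extend (\<lambda>i. a (Some i))" if "a None = 1" for a :: "'a option \<Rightarrow> complex"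
    by (rule ext) (simp add: that split: option.split)
  consider (1) a S b where "\<forall>i. a i \<noteq> 0" "a None = 1" "X = twist (phi a) (module_M S b)"
    | (2) a S b where "\<forall>i. a i \<noteq> 0" "a None = 1" "X = twist (phi a) (twist tau (module_M S b))"
    using assms unfolding category_S_def by blast
  then show thesis
  proof cases
    case 1
    then show ?thesis using that(1)[of "\<lambda>i. a (Some i)" S b] ext[of a] by simp
  next
    case 2
    then show ?thesis using that(2)[of "\<lambda>i. 1 / a (Some i)" S b] ext[of a] by simp
  qed
qed

lemma in_category_S:
  assumes "\<And>i. a i \<noteq> 0"
  shows "twist (phi (extend a)) (module_M S b) \<in> category_S"
    and "twist (phi (extend a)) (twist tau (module_M S b)) \<in> category_S"
  using extend_nonzero[of a, OF assms] unfolding category_S_def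
  by (blast intro: exI[of _ "extend a"] option.case(1))+

lemma category_S_subset: "(category_S :: ('n::finite, 'n mpoly) slmod set) \<subseteq> category_M"
proof
  fix X :: "('n, 'n mpoly) slmod"
  assume "X \<in> category_S"
  then show "X \<in> category_M"
    by (cases rule: category_S_cases)
      (use realises_twist realises_twist_tau realises_category_M in blast)+
qed

text \<open>Two modules realising the same family are isomorphic, so it suffices to match the family
  of \<open>V\<close> with that of a member of \<open>category_S\<close>.\<close>

lemma category_S_exists:
  fixes V :: "('n::finite, 'v::ab_group_add) slmod"
  assumes card: "CARD('n) > 1" and V: "realises V \<Phi> P"
  shows "\<exists>X\<in>category_S. slmod_iso V X"
proof -
  let ?Q = "\<lambda>a S b i j. const (extend a i / extend a j) * unit_poly S b i j"
  interpret P: weight_system P by (rule realises_weight_system[OF V])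
  from P.standard_or_dual[OF card] show ?thesis
  proof
    assume "\<exists>a S b. standard P a S b"
    then obtain a S b where P: "standard P a S b" by blast
    then have a: "\<And>i. a i \<noteq> 0" by (simp add: standard_def)
    note X = realises_twist[of a S b, OF a]
    have "P i j = ?Q a S b i j" if "i \<noteq> j" for i j
      by (rule standard_determines[OF P.weight_system_axioms realises_weight_system[OF X] P
          standard_twist[OF a] that])
    then have "realises V \<Phi> (?Q a S b)" by (rule realises_cong[OF V])
    from realises_iso[OF this X] show ?thesis
      using in_category_S(1)[of a S b, OF a] by blast
  next
    assume "\<exists>a S b. standard (dual P) a S b"
    then obtain a S b where P: "standard (dual P) a S b" by blast
    then have a: "\<And>i. a i \<noteq> 0" by (simp add: standard_def)
    note X = realises_twist[of a S b, OF a]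
    have "dual P j i = ?Q a S b j i" if "i \<noteq> j" for i j
      by (rule standard_determines[OF P.dual_system realises_weight_system[OF X] P
          standard_twist[OF a] that[symmetric]])
    then have "dual (dual P) i j = dual (?Q a S b) i j" if "i \<noteq> j" for i j
      using that unfolding dual_def[of "dual P"] dual_def[of "?Q a S b"] by simp
    then have "P i j = dual (?Q a S b) i j" if "i \<noteq> j" for i j
      using that by simp
    then have "realises V \<Phi> (dual (?Q a S b))" by (rule realises_cong[OF V])
    note realises_iso[OF this realises_twist_tau[of a S b, OF a]]
    moreover have "1 / a i \<noteq> 0" for i using a by simp
    ultimately show ?thesis using in_category_S(2)[of "\<lambda>i. 1 / a i" S b] by blast
  qed
qed

lemma standard_cong:
  assumes "\<And>i j. i \<noteq> j \<Longrightarrow> P i j = Q i j"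
  shows "standard P a S b \<longleftrightarrow> standard Q a S b" "standard (dual P) a S b \<longleftrightarrow> standard (dual Q) a S b"
  using assms by (simp_all add: standard_def up_def dn_def)

text \<open>Isomorphic modules have equal families off the diagonal, so the family of
  \<open>V\<close> decides between the two types and determines the parameters; equal parameters
  give the same module.\<close>

lemma category_S_unique:
  fixes V :: "('n::finite, 'v::ab_group_add) slmod"
  assumes card: "CARD('n) > 1" and V: "realises V \<Phi> P"
    and X: "X \<in> category_S" "slmod_iso V X" and Y: "Y \<in> category_S" "slmod_iso V Y"
  shows "X = Y"
proof -
  let ?Q = "\<lambda>a S b i j. const (extend a i / extend a j) * unit_poly S b i j"
  have form: "(\<exists>a S b. standard P a S b \<and> X = twist (phi (extend a)) (module_M S b)) \<or>
    (\<exists>a S b. standard (dual P) a S b \<and>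
      X = twist (phi (extend (\<lambda>i. 1 / a i))) (twist tau (module_M S b)))"
    if "X \<in> category_S" "slmod_iso V X" for X
    using that(1)
  proof (cases rule: category_S_cases)
    case (1 a S b)
    have "P i j = ?Q a S b i j" if "i \<noteq> j" for i j
      by (rule realises_unique[OF V realises_twist[of a S b, OF 1(1)] _ that])
        (use \<open>slmod_iso V X\<close> 1(2) in simp)
    then have "standard P a S b \<longleftrightarrow> standard (?Q a S b) a S b" by (rule standard_cong(1))
    then have "standard P a S b" using standard_twist[of a S b, OF 1(1)] by simp
    then show ?thesis using 1(2) by blast
  next
    case (2 a S b)
    have "P i j = dual (?Q a S b) i j" if "i \<noteq> j" for i j
      by (rule realises_unique[OF V realises_twist_tau[of a S b, OF 2(1)] _ that])
        (use \<open>slmod_iso V X\<close> 2(2) in simp)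
    then have "standard (dual P) a S b \<longleftrightarrow> standard (dual (dual (?Q a S b))) a S b"
      by (rule standard_cong(2))
    then have "standard (dual P) a S b" using standard_twist[of a S b, OF 2(1)] by simp
    then show ?thesis using 2(2) by blast
  qed
  from form[OF X] form[OF Y] show ?thesis
    using standard_unique[OF card] standard_dual_False[OF card] by metis
qed

theorem theorem30:
  assumes "CARD('n::finite) > 1"
  shows "(category_S :: ('n, 'n mpoly) slmod set) \<subseteq> category_M \<and>
    (\<forall>V \<in> (category_M :: ('n, 'v::ab_group_add) slmod set). \<exists>!X. X \<in> category_S \<and> slmod_iso V X)"
proof (intro conjI ballI category_S_subset)
  fix V :: "('n, 'v) slmod"
  assume "V \<in> category_M"
  then obtain \<Phi> P where V: "realises V \<Phi> P" by (rule category_M_realises)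
  obtain X where "X \<in> category_S" "slmod_iso V X"
    using category_S_exists[OF assms V] by blast
  then show "\<exists>!X. X \<in> category_S \<and> slmod_iso V X"
    using category_S_unique[OF assms V] by blast
qed

end
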